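(* Let $l_1,l_2,m_1,m_2,n\in\mathbb{R}$ and consider the continuous piecewise quadratic differential system $$\dot x=-y+l_jx^2+m_jxy+n\,y^2,\qquad \dot y=x(1-y),\qquad \text{if } (-1)^jx<0,\quad j=1,2$$ (so $j=1$ on $\{x>0\}$ and $j=2$ on $\{x<0\}$). The origin is a center if and only if one of the following conditions holds: \begin{itemize} \item[$(\mathcal V_1^c)$] $l_1-l_2=m_2+m_1=0$; \item[$(\mathcal V_2^c)$] $l_1-l_2=n+l_2=0$; \item[$(\mathcal V_3^c)$] $l_1=l_2=m_2=n=0$; \item[$(\mathcal V_6^c)$] $l_1+1=l_2+1=m_2=n-1=0$; \item[$(\mathcal V_7^c)$] $l_1=l_2=m_1=n=0$; \item[$(\mathcal V_8^c)$] $l_1+1=l_2+1=m_1=n-1=0$. \end{itemize}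
   Context: The separation line is $\{x=0\}$. The origin is a center if some punctured neighborhood of it is filled with crossing periodic orbits surrounding the origin. Here a crossing periodic orbit is obtained by concatenating orbit arcs of the system in $\{x>0\}$ and of the system in $\{x<0\}$ at points of $\{x=0\}$ where both vector fields are transversal to this line and point to the same side. *)

theory Defs
  imports "HOL-Analysis.Analysis"
begin

text \<open>A piecewise smooth planar system with separation line \<open>x = 0\<close> is given by a pair of
  vector fields: \<open>X\<close> governs \<open>x > 0\<close> and \<open>Y\<close> governs \<open>x < 0\<close>.\<close>

type_synonym planar_field = "real \<times> real \<Rightarrow> real \<times> real"

definition quad_field :: "real \<Rightarrow> real \<Rightarrow> real \<Rightarrow> planar_field" where
  "quad_field l m n = (\<lambda>(x, y). (- y + l * x\<^sup>2 + m * x * y + n * y\<^sup>2, x * (1 - y)))"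

text \<open>The product condition says that both normal components are nonzero (transversality) and
  have the same sign (both fields point to the same side).\<close>

definition crossing_point :: "planar_field \<Rightarrow> planar_field \<Rightarrow> real \<times> real \<Rightarrow> bool" where
  "crossing_point X Y p \<longleftrightarrow> fst p = 0 \<and> fst (X p) * fst (Y p) > 0"

definition right_orbit_on :: "planar_field \<Rightarrow> (real \<Rightarrow> real \<times> real) \<Rightarrow> real set \<Rightarrow> bool" where
  "right_orbit_on X \<gamma> I \<longleftrightarrow>
     (\<forall>s\<in>I. fst (\<gamma> s) > 0 \<and> (\<gamma> has_vector_derivative X (\<gamma> s)) (at s))"

definition left_orbit_on :: "planar_field \<Rightarrow> (real \<Rightarrow> real \<times> real) \<Rightarrow> real set \<Rightarrow> bool" where
  "left_orbit_on Y \<gamma> I \<longleftrightarrow>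
     (\<forall>s\<in>I. fst (\<gamma> s) < 0 \<and> (\<gamma> has_vector_derivative Y (\<gamma> s)) (at s))"

text \<open>The arcs are the restrictions of \<open>\<gamma>\<close> to the intervals \<open>[t i, t (i + 1)]\<close>. That arcs on the
  two sides alternate need not be required: at a crossing point an arc arriving from one side
  can only be continued into the other side.\<close>

definition crossing_periodic_orbit ::
    "planar_field \<Rightarrow> planar_field \<Rightarrow> (real \<times> real) set \<Rightarrow> bool" where
  "crossing_periodic_orbit X Y \<Gamma> \<longleftrightarrow>
     (\<exists>(\<gamma> :: real \<Rightarrow> real \<times> real) (k :: nat) (t :: nat \<Rightarrow> real).
        k > 0 \<and>
        (\<forall>i<k. t i < t (Suc i)) \<and>
        continuous_on {t 0..t k} \<gamma> \<and>
        (\<forall>i\<le>k. crossing_point X Y (\<gamma> (t i))) \<and>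
        (\<forall>i<k. right_orbit_on X \<gamma> {t i<..<t (Suc i)} \<or>
               left_orbit_on Y \<gamma> {t i<..<t (Suc i)}) \<and>
        \<gamma> (t k) = \<gamma> (t 0) \<and>
        \<Gamma> = \<gamma> ` {t 0..t k})"

text \<open>A neighborhood \<open>U\<close> of the origin need not be open. An orbit \<open>\<Gamma>\<close> surrounds the origin if
  the origin lies in a bounded component of the complement of \<open>\<Gamma>\<close>.\<close>

definition origin_is_center :: "planar_field \<Rightarrow> planar_field \<Rightarrow> bool" where
  "origin_is_center X Y \<longleftrightarrow>
     (\<exists>U \<C>. (0, 0) \<in> interior U \<and>
        (\<forall>\<Gamma>\<in>\<C>. crossing_periodic_orbit X Y \<Gamma> \<and> (0, 0) \<in> inside \<Gamma>) \<and>
        U - {(0, 0)} = \<Union>\<C>)"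

end

theory Submission
  imports Defs
begin

text \<open>The reflection \<open>(x, y, t) \<mapsto> (- x, y, - t)\<close> turns arcs in \<open>x < 0\<close> into arcs in \<open>x > 0\<close> of the
  system with \<open>m\<^sub>2\<close> replaced by \<open>- m\<^sub>2\<close>, so one has to compare the half-return maps of two systems in
  \<open>x > 0\<close>. There \<open>y\<close> is increasing and the arcs are graphs \<open>x = f y\<close>. With \<open>z = x / (1 - n y)\<close>, \<open>c = n (1 - n)\<close> and
  \<open>W = \<integral>\<^sub>0\<^sup>z s / (1 - m s + c s\<^sup>2) ds\<close> the equation becomes
  \<open>W' = - y / ((1 - y) (1 - n y)) + (l + n) K / (1 - y)\<close>, where \<open>K = z\<^sup>2 / (1 - m z + c z\<^sup>2)\<close>.
  If \<open>l + n = 0\<close>, the half-return map does not depend on \<open>m\<close>. In general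
  \<open>K = 2 W + (m/3) (2 W)\<^bsup>3/2\<^esup> + o(W\<^bsup>3/2\<^esup>)\<close> and comparing two solutions shows that the half-return maps are
  strictly ordered near the origin unless \<open>l\<^sub>1 = l\<^sub>2\<close> and \<open>(l\<^sub>1 + n) (m\<^sub>1 + m\<^sub>2) = 0\<close>; then all orbits
  spiral. The conditions \<open>V\<^sub>3\<close>, \<open>V\<^sub>6\<close>, \<open>V\<^sub>7\<close>, \<open>V\<^sub>8\<close> are special cases of \<open>V\<^sub>2\<close>.\<close>

text \<open>The slope \<open>dx/dy\<close> of a half-arc has \<open>x\<close> in its denominator and
  so is singular at both ends. In the variable \<open>W\<close>, which is about
  \<open>z^2 / 2\<close>, this denominator is gone, and the part of the equation without
  \<open>K\<close> is the same for both systems, so it cancels from the difference of two solutions.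
  What remains has to be bounded only from one side, strictly, by \<open>- L\<close> times the
  distance of the two values of \<open>W\<close>; this orders the half-return maps without computing
  expansions of them. A crossing periodic orbit may have any number of arcs, and some of them may
  run far from the origin, so it cannot be assumed to close after two arcs. It is reduced to the
  finite set of heights at which it crosses \<open>x = 0\<close>, with links between consecutive
  heights, and an extremal height is compared with the next ones. An energy estimate guarantees that
  an arc with one end near the origin is small in the range where the comparison takes
  place.\<close>

section \<open>Differential inequalities and Picard iteration\<close>

text \<open>Where \<open>D\<close> is negative the hypothesis reads \<open>D' y > L * D y\<close>,
  so \<open>exp (- L * y) * D y\<close> increases strictly and \<open>D\<close> cannot become
  negative after a point where it is nonnegative. Once \<open>D\<close> is known to be nonnegative,
  \<open>exp (L * y) * D y\<close> increases strictly, which would make \<open>D b\<close>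
  positive.\<close>

lemma DERIV_superlinear_no_return:
  fixes D D' :: "real \<Rightarrow> real"
  assumes "a < b" and cont: "continuous_on {a..b} D"
    and der: "\<And>y. a < y \<Longrightarrow> y < b \<Longrightarrow> (D has_real_derivative D' y) (at y)"
    and gt: "\<And>y. a < y \<Longrightarrow> y < b \<Longrightarrow> D' y > - L * \<bar>D y\<bar>"
    and "D a \<ge> 0" "D b \<le> 0"
  shows False
proof -
  have derE: "((\<lambda>y. exp (c * y) * D y) has_real_derivative exp (c * y) * (D' y + c * D y)) (at y)"
    if "a < y" "y < b" for c y
    by (auto intro!: derivative_eq_intros der that simp: algebra_simps)
  have contE: "continuous_on {p..q} (\<lambda>y. exp (c * y) * D y)" if "a \<le> p" "q \<le> b" for c p q
    by (intro continuous_intros continuous_on_subset[OF cont]) (use that in auto)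
  have nonneg: "D p \<ge> 0" if p: "a \<le> p" "p \<le> b" for p
  proof (rule ccontr)
    assume neg: "\<not> D p \<ge> 0"
    \<comment> \<open>\<open>Sup S\<close> is the last point before \<open>p\<close> at which
      \<open>D\<close> is nonnegative; between it and \<open>p\<close> only negative values
      occur.\<close>
    define S where "S = {a..p} \<inter> D -` {0..}"
    have "closed S" unfolding S_def
      by (intro continuous_closed_preimage continuous_on_subset[OF cont]) (use p in auto)
    moreover have "a \<in> S" using assms p by (auto simp: S_def)
    moreover have bdd: "bdd_above S" by (auto simp: S_def intro!: bdd_aboveI[of _ p])
    ultimately have "Sup S \<in> S" using closed_contains_Sup by blast
    define q where "q = Sup S"
    have q: "a \<le> q" "q \<le> p" "D q \<ge> 0" using \<open>Sup S \<in> S\<close> by (auto simp: q_def S_def)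
    then have "q < p" using neg by (cases "q = p") auto
    have above: "D y < 0" if "q < y" "y \<le> p" for y
    proof (rule ccontr)
      assume "\<not> D y < 0"
      then have "y \<in> S" using that q by (auto simp: S_def)
      then show False using cSup_upper[OF _ bdd] that by (fastforce simp: q_def)
    qed
    have "exp (- L * q) * D q < exp (- L * p) * D p"
    proof (rule DERIV_pos_imp_increasing_open[OF \<open>q < p\<close>])
      fix y assume y: "q < y" "y < p"
      have sgn: "D' y - L * D y > 0" using gt[of y] above[of y] y p q by (auto simp: abs_if)
      show "\<exists>z. ((\<lambda>y. exp (- L * y) * D y) has_real_derivative z) (at y) \<and> 0 < z"
        by (rule exI, rule conjI, rule derE) (use sgn y p q in auto)
    qed (use contE[of q p "- L"] p q in auto)
    moreover have "exp (- L * q) * D q \<ge> 0" using q by simp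
    moreover have "exp (- L * p) * D p < 0" using neg by (simp add: mult_pos_neg)
    ultimately show False by simp
  qed
  have "exp (L * a) * D a < exp (L * b) * D b"
  proof (rule DERIV_pos_imp_increasing_open[OF \<open>a < b\<close>])
    fix y assume y: "a < y" "y < b"
    have sgn: "D' y + L * D y > 0" using gt[of y] nonneg[of y] y by auto
    show "\<exists>z. ((\<lambda>y. exp (L * y) * D y) has_real_derivative z) (at y) \<and> 0 < z"
      by (rule exI, rule conjI, rule derE) (use sgn y in auto)
  qed (use contE[of a b L] in auto)
  moreover have "exp (L * a) * D a \<ge> 0" using assms by simp
  moreover have "exp (L * b) * D b \<le> 0" using assms by (simp add: mult_nonneg_nonpos)
  ultimately show False by simp
qed

text \<open>Multiplication by \<open>exp (C * y)\<close> makes \<open>V\<close> nondecreasing,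
  multiplication by \<open>exp (- C * y)\<close> makes it nonincreasing. Both directions are kept
  because the point with the known value may later lie on either side.\<close>

lemma gronwall_two_sided:
  fixes V V' :: "real \<Rightarrow> real"
  assumes cont: "continuous_on {a..b} V"
    and der: "\<And>y. a < y \<Longrightarrow> y < b \<Longrightarrow> (V has_real_derivative V' y) (at y)"
    and bnd: "\<And>y. a < y \<Longrightarrow> y < b \<Longrightarrow> \<bar>V' y\<bar> \<le> C * V y"
    and y: "y1 \<in> {a..b}" "y2 \<in> {a..b}"
  shows "V y1 \<le> exp (C * \<bar>y1 - y2\<bar>) * V y2"
proof -
  have derE: "((\<lambda>y. exp (c * y) * V y) has_real_derivative exp (c * y) * (V' y + c * V y)) (at y)"
    if "a < y" "y < b" for c y
    by (auto intro!: derivative_eq_intros der that simp: algebra_simps)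
  have contE: "continuous_on {p..q} (\<lambda>y. exp (c * y) * V y)" if "a \<le> p" "q \<le> b" for c p q
    by (intro continuous_intros continuous_on_subset[OF cont]) (use that in auto)
  show ?thesis
  proof (cases "y1 \<le> y2")
    case True
    have "exp (C * y1) * V y1 \<le> exp (C * y2) * V y2"
    proof (rule DERIV_nonneg_imp_increasing_open[OF True])
      fix z assume z: "y1 < z" "z < y2"
      have sgn: "V' z + C * V z \<ge> 0" using bnd[of z] z y by auto
      show "\<exists>d. ((\<lambda>y. exp (C * y) * V y) has_real_derivative d) (at z) \<and> 0 \<le> d"
        by (rule exI, rule conjI, rule derE) (use sgn z y in auto)
    qed (use contE[of y1 y2 C] y in auto)
    then have "exp (- (C * y1)) * (exp (C * y1) * V y1) \<le> exp (- (C * y1)) * (exp (C * y2) * V y2)"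
      by (rule mult_left_mono) simp
    moreover have "exp (- (C * y1)) * (exp (C * y1) * V y1) = V y1"
      by (simp add: exp_minus field_simps)
    moreover have "exp (- (C * y1)) * (exp (C * y2) * V y2) = exp (C * (y2 - y1)) * V y2"
      by (simp add: right_diff_distrib exp_diff exp_minus field_simps)
    ultimately have "V y1 \<le> exp (C * (y2 - y1)) * V y2" by (simp only:)
    then show ?thesis using True by simp
  next
    case False
    have "- (exp (- C * y2) * V y2) \<le> - (exp (- C * y1) * V y1)"
    proof (rule DERIV_nonneg_imp_increasing_open[of y2 y1])
      fix z assume z: "y2 < z" "z < y1"
      have sgn: "V' z - C * V z \<le> 0" using bnd[of z] z y by auto
      show "\<exists>d. ((\<lambda>y. - (exp (- C * y) * V y)) has_real_derivative d) (at z) \<and> 0 \<le> d"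
        by (rule exI, rule conjI, rule DERIV_minus, rule derE) (use sgn z y in \<open>auto simp: mult_nonneg_nonpos\<close>)
    qed (use contE[of y2 y1 "- C"] y False in \<open>auto intro: continuous_on_minus\<close>)
    then have "exp (C * y1) * (exp (- C * y1) * V y1) \<le> exp (C * y1) * (exp (- C * y2) * V y2)"
      by (intro mult_left_mono) auto
    moreover have "exp (C * y1) * (exp (- C * y1) * V y1) = V y1"
      by (simp add: exp_minus field_simps)
    moreover have "exp (C * y1) * (exp (- C * y2) * V y2) = exp (C * (y1 - y2)) * V y2"
      by (simp add: right_diff_distrib exp_diff exp_minus field_simps)
    ultimately have "V y1 \<le> exp (C * (y1 - y2)) * V y2" by (simp only:)
    then show ?thesis using False by simp
  qed
qed

text \<open>An integral over \<open>{0..t}\<close> would be 0 for negative \<open>t\<close>, so the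
  oriented integral from 0 is written with the base point \<open>- \<tau>\<close>. Its two parts
  extend over lengths of at most \<open>2 * \<tau>\<close> and \<open>\<tau>\<close>, whence the
  factor 3.\<close>

lemma integral_from_zero_bound:
  fixes g :: "real \<Rightarrow> 'a::banach"
  assumes cont: "continuous_on {-\<tau>..\<tau>} g" and B: "\<And>s. s \<in> {-\<tau>..\<tau>} \<Longrightarrow> norm (g s) \<le> B"
    and t: "t \<in> {-\<tau>..\<tau>}"
  shows "norm (integral {-\<tau>..t} g - integral {-\<tau>..0} g) \<le> 3 * \<tau> * B"
proof -
  have "B \<ge> 0" using B[of 0] t norm_ge_zero[of "g 0"] by (smt (verit) atLeastAtMost_iff)
  have *: "norm (integral {-\<tau>..u} g) \<le> B * (u + \<tau>)" if "u \<in> {-\<tau>..\<tau>}" for u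
    using integral_bound[of "-\<tau>" u g B] that B continuous_on_subset[OF cont] by auto
  have "norm (integral {-\<tau>..t} g - integral {-\<tau>..0} g) \<le> B * (t + \<tau>) + B * (0 + \<tau>)"
    by (intro order_trans[OF norm_triangle_ineq4] add_mono *) (use t in auto)
  also have "\<dots> = B * (t + 2 * \<tau>)" by (simp add: algebra_simps)
  also have "\<dots> \<le> B * (3 * \<tau>)" using \<open>B \<ge> 0\<close> t by (intro mult_left_mono) auto
  finally show ?thesis by (simp add: mult_ac)
qed

text \<open>Banach's fixed point theorem for the integral operator on the bounded continuous
  functions with values in \<open>cball p R\<close>: \<open>3 * \<tau> * B \<le> R\<close> makes it
  map this closed set into itself, \<open>3 * \<tau> * L < 1\<close> makes it a contraction.\<close>

lemma picard_lindeloef_ball: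
  fixes G :: "real \<Rightarrow> 'a::banach \<Rightarrow> 'a" and p :: 'a
  assumes cont: "continuous_on UNIV (\<lambda>(t, u). G t u)"
    and pos: "\<tau> > 0" "R \<ge> 0" "L \<ge> 0"
    and B: "\<And>t u. norm (u - p) \<le> R \<Longrightarrow> norm (G t u) \<le> B" "3 * \<tau> * B \<le> R"
    and L: "\<And>t u v. norm (u - p) \<le> R \<Longrightarrow> norm (v - p) \<le> R \<Longrightarrow>
              norm (G t u - G t v) \<le> L * norm (u - v)" "3 * \<tau> * L < 1"
  obtains \<zeta> where "\<zeta> 0 = p" "\<And>t. norm (\<zeta> t - p) \<le> R"
    "\<And>t. t \<in> {-\<tau><..<\<tau>} \<Longrightarrow> (\<zeta> has_vector_derivative G t (\<zeta> t)) (at t)"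
proof -
  define S where "S = {\<zeta> :: real \<Rightarrow>\<^sub>C 'a. \<forall>t. apply_bcontfun \<zeta> t \<in> cball p R}"
  \<comment> \<open>Clamping the time to \<open>[- \<tau>, \<tau>]\<close> lets the operator act on
    bounded functions defined on the whole line; inside the interval it is the usual Picard
    operator.\<close>
  define c where "c = (\<lambda>t. max (-\<tau>) (min \<tau> t))"
  define I where "I = (\<lambda>(\<zeta> :: real \<Rightarrow>\<^sub>C 'a) t. integral {-\<tau>..t} (\<lambda>s. G s (apply_bcontfun \<zeta> s)))"
  define F where "F = (\<lambda>\<zeta> t. p + (I \<zeta> (c t) - I \<zeta> 0))"
  have c: "c t \<in> {-\<tau>..\<tau>}" for t using pos by (auto simp: c_def)
  have contG: "continuous_on T (\<lambda>s. G s (apply_bcontfun \<zeta> s))" for T \<zeta>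
  proof -
    have "continuous_on T (\<lambda>s. (s, apply_bcontfun \<zeta> s))"
      by (intro continuous_on_Pair continuous_on_id continuous_on_apply_bcontfun)
    then show ?thesis
      using continuous_on_compose2[OF cont, of T "\<lambda>s. (s, apply_bcontfun \<zeta> s)"] by simp
  qed
  have "closed (PiC UNIV (\<lambda>_::real. cball p R))" by (rule closed_PiC) auto
  moreover have "PiC UNIV (\<lambda>_::real. cball p R) = S" by (force simp: S_def mem_PiC_iff)
  ultimately have "closed S" by simp
  then have "complete S" by (simp add: complete_eq_closed)
  have "const_bcontfun p \<in> S" using pos by (simp add: S_def)
  have S_norm: "norm (apply_bcontfun \<zeta> s - p) \<le> R" if "\<zeta> \<in> S" for \<zeta> s
    using that by (simp add: S_def dist_norm norm_minus_commute)
  have F_ball: "norm (F \<zeta> t - p) \<le> R" if "\<zeta> \<in> S" for \<zeta> t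
  proof -
    have "norm (I \<zeta> (c t) - I \<zeta> 0) \<le> 3 * \<tau> * B" unfolding I_def
      by (rule integral_from_zero_bound[OF contG _ c]) (simp add: B S_norm[OF that])
    then show ?thesis using B by (simp add: F_def)
  qed
  have F_cont: "continuous_on UNIV (F \<zeta>)" for \<zeta>
  proof -
    have "continuous_on {-\<tau>..\<tau>} (I \<zeta>)" unfolding I_def
      by (rule indefinite_integral_continuous_1) (rule integrable_continuous_real[OF contG])
    moreover have "continuous_on UNIV c" unfolding c_def by (intro continuous_intros)
    ultimately have "continuous_on UNIV (\<lambda>t. I \<zeta> (c t))"
      using continuous_on_compose2[of "{-\<tau>..\<tau>}" "I \<zeta>" UNIV c] c by blast
    then show ?thesis unfolding F_def by (intro continuous_intros)
  qed
  have F_bcont: "F \<zeta> \<in> bcontfun" if "\<zeta> \<in> S" for \<zeta>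
  proof (rule bcontfun_normI[OF F_cont])
    fix t
    show "norm (F \<zeta> t) \<le> R + norm p"
      using F_ball[OF that, of t] norm_triangle_sub[of "F \<zeta> t" p] by linarith
  qed
  have app: "apply_bcontfun (Bcontfun (F \<zeta>)) = F \<zeta>" if "\<zeta> \<in> S" for \<zeta>
    using F_bcont[OF that] by (simp add: Bcontfun_inverse)
  have "\<exists>!\<zeta>\<in>S. Bcontfun (F \<zeta>) = \<zeta>"
  proof (rule Banach_fix[OF \<open>complete S\<close>])
    show "S \<noteq> {}" using \<open>const_bcontfun p \<in> S\<close> by auto
    show "0 \<le> 3 * \<tau> * L" "3 * \<tau> * L < 1" using pos L by auto
    show "(\<lambda>\<zeta>. Bcontfun (F \<zeta>)) ` S \<subseteq> S"
      using F_ball app by (auto simp: S_def dist_norm norm_minus_commute)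
    fix \<zeta> \<xi> assume in_S: "\<zeta> \<in> S" "\<xi> \<in> S"
    have "dist (F \<zeta> t) (F \<xi> t) \<le> 3 * \<tau> * L * dist \<zeta> \<xi>" for t
    proof -
      have sub: "I \<zeta> u - I \<xi> u =
          integral {-\<tau>..u} (\<lambda>s. G s (apply_bcontfun \<zeta> s) - G s (apply_bcontfun \<xi> s))" for u
        unfolding I_def
        by (rule Henstock_Kurzweil_Integration.integral_diff[symmetric])
           (intro integrable_continuous_real contG)+
      have "dist (F \<zeta> t) (F \<xi> t) = norm ((I \<zeta> (c t) - I \<xi> (c t)) - (I \<zeta> 0 - I \<xi> 0))"
        by (simp add: F_def dist_norm algebra_simps)
      also have "\<dots> \<le> 3 * \<tau> * (L * dist \<zeta> \<xi>)" unfolding sub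
      proof (rule integral_from_zero_bound[OF _ _ c])
        fix s
        have "norm (apply_bcontfun \<zeta> s - apply_bcontfun \<xi> s) \<le> dist \<zeta> \<xi>"
          using dist_bounded[of \<zeta> s \<xi>] by (simp add: dist_norm)
        then show "norm (G s (apply_bcontfun \<zeta> s) - G s (apply_bcontfun \<xi> s)) \<le> L * dist \<zeta> \<xi>"
          using order_trans[OF L(1)[OF S_norm[OF in_S(1)] S_norm[OF in_S(2)]]] pos
          by (meson mult_left_mono)
      qed (intro continuous_intros contG)
      finally show ?thesis by (simp add: mult_ac)
    qed
    then show "dist (Bcontfun (F \<zeta>)) (Bcontfun (F \<xi>)) \<le> 3 * \<tau> * L * dist \<zeta> \<xi>"
      by (intro dist_bound) (simp add: app in_S)
  qed
  then obtain \<zeta> where \<zeta>: "\<zeta> \<in> S" "Bcontfun (F \<zeta>) = \<zeta>" by blast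
  then have fix_eq: "apply_bcontfun \<zeta> = F \<zeta>" using app[OF \<zeta>(1)] by simp
  show ?thesis
  proof
    show "F \<zeta> 0 = p" using pos by (simp add: F_def c_def)
    show "norm (F \<zeta> t - p) \<le> R" for t using F_ball[OF \<zeta>(1)] .
    fix t assume t: "t \<in> {-\<tau><..<\<tau>}"
    have "(I \<zeta> has_vector_derivative G t (apply_bcontfun \<zeta> t)) (at t within {-\<tau>..\<tau>})"
      unfolding I_def by (rule integral_has_vector_derivative[OF contG]) (use t in auto)
    then have "(I \<zeta> has_vector_derivative G t (F \<zeta> t)) (at t)"
      using t fix_eq by (simp add: at_within_Icc_at)
    then have "((\<lambda>t. p + (I \<zeta> t - I \<zeta> 0)) has_vector_derivative G t (F \<zeta> t)) (at t)"
      by (auto intro!: derivative_eq_intros)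
    then show "(F \<zeta> has_vector_derivative G t (F \<zeta> t)) (at t)"
      by (rule has_vector_derivative_transform_within_open[where S="{-\<tau><..<\<tau>}"])
         (use t in \<open>auto simp: F_def c_def\<close>)
  qed
qed

section \<open>Half-arcs as graphs over the y-axis\<close>

text \<open>The slope is the quotient of the two components of the field at \<open>(f y, y)\<close>.
  It is prescribed only inside the interval, since its denominator vanishes at both ends.\<close>

definition half_arc :: "real \<Rightarrow> real \<Rightarrow> real \<Rightarrow> real \<Rightarrow> real \<Rightarrow> (real \<Rightarrow> real) \<Rightarrow> bool" where
  "half_arc l m n a b f \<longleftrightarrow> a < b \<and> continuous_on {a..b} f \<and> f a = 0 \<and> f b = 0 \<and>
     (\<forall>y\<in>{a<..<b}. f y > 0 \<and>
        (f has_real_derivative (- y + l * (f y)\<^sup>2 + m * f y * y + n * y\<^sup>2) / (f y * (1 - y))) (at y))"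

lemma half_arc_nonneg: "half_arc l m n a b f \<Longrightarrow> y \<in> {a..b} \<Longrightarrow> f y \<ge> 0"
  unfolding half_arc_def by (cases "y = a \<or> y = b") (auto intro: less_imp_le)

lemma quadratic_form_le:
  fixes x y :: real
  shows "\<bar>p * y\<^sup>2 + l * x\<^sup>2 + m * x * y\<bar> \<le> (\<bar>p\<bar> + \<bar>l\<bar> + \<bar>m\<bar>) * (x\<^sup>2 + y\<^sup>2)"
proof -
  have xy: "\<bar>x * y\<bar> \<le> x\<^sup>2 + y\<^sup>2"
    using sum_squares_bound[of x y] sum_squares_bound[of x "- y"] zero_le_power2[of x] zero_le_power2[of y]
    by (auto simp: abs_if)
  have "\<bar>p * y\<^sup>2 + l * x\<^sup>2 + m * x * y\<bar> \<le> \<bar>p\<bar> * y\<^sup>2 + \<bar>l\<bar> * x\<^sup>2 + \<bar>m\<bar> * \<bar>x * y\<bar>"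
    using abs_triangle_ineq[of "p * y\<^sup>2 + l * x\<^sup>2" "m * x * y"] abs_triangle_ineq[of "p * y\<^sup>2" "l * x\<^sup>2"]
    by (simp add: abs_mult mult.assoc)
  also have "\<dots> \<le> \<bar>p\<bar> * (x\<^sup>2 + y\<^sup>2) + \<bar>l\<bar> * (x\<^sup>2 + y\<^sup>2) + \<bar>m\<bar> * (x\<^sup>2 + y\<^sup>2)"
    by (intro add_mono mult_left_mono xy) auto
  finally show ?thesis by (simp add: algebra_simps)
qed

text \<open>The linear part of the system is a rotation, so the linear terms cancel in the
  derivative of \<open>(f y)\<^sup>2 + y\<^sup>2\<close> and a quadratic form divided by
  \<open>1 - y\<close> remains. The energy itself dominates it, and Gronwall applies over a length
  of at most 1.\<close>

lemma half_arc_energy: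
  assumes arc: "half_arc l m n a b f"
    and y: "y1 \<in> {a..b}" "y2 \<in> {a..b}" "\<bar>y1\<bar> \<le> 1/2" "\<bar>y2\<bar> \<le> 1/2"
  shows "(f y1)\<^sup>2 + y1\<^sup>2 \<le> exp (4 * (\<bar>n - 1\<bar> + \<bar>l\<bar> + \<bar>m\<bar>)) * ((f y2)\<^sup>2 + y2\<^sup>2)"
proof -
  define K where "K = \<bar>n - 1\<bar> + \<bar>l\<bar> + \<bar>m\<bar>"
  define C where "C = 4 * K"
  have "K \<ge> 0" by (simp add: K_def)
  define V where "V = (\<lambda>y. (f y)\<^sup>2 + y\<^sup>2)"
  define V' where "V' = (\<lambda>y. 2 * ((n - 1) * y\<^sup>2 + l * (f y)\<^sup>2 + m * f y * y) / (1 - y))"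
  have "V y1 \<le> exp (C * \<bar>y1 - y2\<bar>) * V y2"
  proof (rule gronwall_two_sided)
    have "continuous_on {max a (-1/2)..min b (1/2)} f"
      by (rule continuous_on_subset[of "{a..b}"]) (use arc in \<open>auto simp: half_arc_def\<close>)
    then show "continuous_on {max a (-1/2)..min b (1/2)} V"
      unfolding V_def by (intro continuous_intros)
    fix y assume y: "max a (-1/2) < y" "y < min b (1/2)"
    then have fy: "f y > 0"
      and der: "(f has_real_derivative (- y + l * (f y)\<^sup>2 + m * f y * y + n * y\<^sup>2) / (f y * (1 - y))) (at y)"
      using arc by (auto simp: half_arc_def)
    have "2 * f y * ((- y + l * (f y)\<^sup>2 + m * f y * y + n * y\<^sup>2) / (f y * (1 - y))) + 2 * y = V' y"
      using fy y by (simp add: V'_def divide_simps) (simp add: algebra_simps power2_eq_square)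
    then show "(V has_real_derivative V' y) (at y)" unfolding V_def
      by (auto intro!: derivative_eq_intros der)
    have "\<bar>V' y\<bar> = 2 * \<bar>(n - 1) * y\<^sup>2 + l * (f y)\<^sup>2 + m * f y * y\<bar> / (1 - y)"
      using y by (simp only: V'_def abs_mult abs_divide)
    also have "\<dots> \<le> 2 * \<bar>(n - 1) * y\<^sup>2 + l * (f y)\<^sup>2 + m * f y * y\<bar> / (1/2)"
      using y by (intro divide_left_mono) auto
    also have "\<dots> \<le> C * V y"
      using quadratic_form_le[of "n - 1" y l "f y" m, folded K_def] by (simp add: C_def V_def)
    finally show "\<bar>V' y\<bar> \<le> C * V y" .
  qed (use y in auto)
  also have "\<dots> \<le> exp (C * 1) * V y2"
    using y \<open>K \<ge> 0\<close>
    by (intro mult_right_mono) (auto simp: C_def V_def intro!: mult_left_le)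
  finally show ?thesis by (simp add: V_def C_def K_def)
qed

text \<open>At a zero of \<open>f\<close> the energy is just \<open>y2\<^sup>2\<close>, so one end
  close to the origin controls the part of the arc with \<open>\<bar>y1\<bar> \<le> 1/2\<close>. The
  bound \<open>\<epsilon>\<close> is uniform over all arcs; the other end may be anywhere.\<close>

lemma half_arc_small:
  assumes "\<rho> > 0"
  obtains \<epsilon> where "0 < \<epsilon>" "\<epsilon> \<le> 1/2"
    "\<And>a b f y1 y2. half_arc l m n a b f \<Longrightarrow> y1 \<in> {a..b} \<Longrightarrow> y2 \<in> {a..b} \<Longrightarrow> f y2 = 0 \<Longrightarrow>
       \<bar>y1\<bar> \<le> 1/2 \<Longrightarrow> \<bar>y2\<bar> < \<epsilon> \<Longrightarrow> \<bar>f y1\<bar> < \<rho> \<and> \<bar>y1\<bar> < \<rho>"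
proof -
  define E where "E = exp (2 * (\<bar>n - 1\<bar> + \<bar>l\<bar> + \<bar>m\<bar>))"
  have E: "E > 0" "E\<^sup>2 = exp (4 * (\<bar>n - 1\<bar> + \<bar>l\<bar> + \<bar>m\<bar>))"
    by (simp_all add: E_def exp_double[symmetric])
  show ?thesis
  proof
    show "0 < min (1/2) (\<rho> / E)" using assms E by auto
    show "min (1/2) (\<rho> / E) \<le> 1/2" by (rule min.cobounded1)
    fix a b f y1 y2
    assume arc: "half_arc l m n a b f" "y1 \<in> {a..b}" "y2 \<in> {a..b}" "f y2 = 0" "\<bar>y1\<bar> \<le> 1/2"
      "\<bar>y2\<bar> < min (1/2) (\<rho> / E)"
    have "(f y1)\<^sup>2 + y1\<^sup>2 \<le> (E * \<bar>y2\<bar>)\<^sup>2"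
      using half_arc_energy[OF arc(1-3)] arc by (simp add: E power_mult_distrib)
    also have "E * \<bar>y2\<bar> < \<rho>" using arc E by (simp add: field_simps)
    then have "(E * \<bar>y2\<bar>)\<^sup>2 < \<rho>\<^sup>2" using E by (intro power_strict_mono) auto
    finally have lt: "(f y1)\<^sup>2 + y1\<^sup>2 < \<rho>\<^sup>2" .
    then have "\<bar>f y1\<bar>\<^sup>2 < \<rho>\<^sup>2" "\<bar>y1\<bar>\<^sup>2 < \<rho>\<^sup>2"
      using zero_le_power2[of y1] zero_le_power2[of "f y1"] unfolding power2_abs by linarith+
    then show "\<bar>f y1\<bar> < \<rho> \<and> \<bar>y1\<bar> < \<rho>"
      using power_less_imp_less_base[of "\<bar>f y1\<bar>" 2 \<rho>] power_less_imp_less_base[of "\<bar>y1\<bar>" 2 \<rho>] assms by auto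
  qed
qed

section \<open>The functions W and K of the overview and their expansion at 0\<close>

text \<open>Up to this radius \<open>1 - m * z + c * z\<^sup>2\<close> is at least 1/2, so the
  integrand of \<open>Psi\<close> has no pole.\<close>

definition rad :: "real \<Rightarrow> real \<Rightarrow> real" where
  "rad m c = 1 / (2 * (1 + \<bar>m\<bar> + \<bar>c\<bar>))"

text \<open>With \<open>c = n * (1 - n)\<close> this is \<open>W\<close> as a function of
  \<open>z\<close>. With the parameters \<open>1 + n\<close> and \<open>n\<close> it is also a
  primitive of \<open>y / ((1 - y) * (1 - n * y))\<close>; there negative arguments occur, hence the
  difference of two integrals.\<close>

definition Psi :: "real \<Rightarrow> real \<Rightarrow> real \<Rightarrow> real" where
  "Psi m c z = integral {- rad m c..z} (\<lambda>s. s / (1 - m * s + c * s\<^sup>2))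
             - integral {- rad m c..0} (\<lambda>s. s / (1 - m * s + c * s\<^sup>2))"

lemma rad_pos: "rad m c > 0"
  by (simp add: rad_def add_pos_nonneg)

lemma denominator_ge_half:
  assumes "\<bar>z\<bar> \<le> rad m c"
  shows "1 - m * z + c * z\<^sup>2 \<ge> 1/2"
proof -
  have "rad m c \<le> 1" by (simp add: rad_def divide_simps)
  then have "\<bar>z\<bar> \<le> 1" using assms by simp
  have "\<bar>m * z\<bar> + \<bar>c * z\<^sup>2\<bar> \<le> \<bar>m\<bar> * \<bar>z\<bar> + \<bar>c\<bar> * \<bar>z\<bar>"
    using \<open>\<bar>z\<bar> \<le> 1\<close> mult_left_le[of "\<bar>z\<bar>" "\<bar>z\<bar>"]
    by (intro add_mono) (auto simp: abs_mult power2_eq_square intro!: mult_left_mono)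
  also have "\<dots> \<le> (1 + \<bar>m\<bar> + \<bar>c\<bar>) * \<bar>z\<bar>" by (simp add: algebra_simps)
  also have "\<dots> \<le> (1 + \<bar>m\<bar> + \<bar>c\<bar>) * rad m c" using assms by (intro mult_left_mono) auto
  also have "\<dots> = 1/2" using abs_ge_zero[of m] abs_ge_zero[of c]
    by (simp add: rad_def divide_simps)
  finally show ?thesis by linarith
qed

lemma Psi_zero [simp]: "Psi m c 0 = 0"
  by (simp add: Psi_def)

lemma Psi_deriv:
  assumes "\<bar>z\<bar> < rad m c"
  shows "(Psi m c has_real_derivative z / (1 - m * z + c * z\<^sup>2)) (at z)"
proof -
  let ?g = "\<lambda>s. s / (1 - m * s + c * s\<^sup>2)"
  have "continuous_on {- rad m c..rad m c} ?g"
    using denominator_ge_half[of _ m c] by (intro continuous_intros ballI) (force simp: abs_le_iff)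
  then have "((\<lambda>x. integral {- rad m c..x} ?g) has_real_derivative ?g z) (at z within {- rad m c..rad m c})"
    by (rule integral_has_real_derivative) (use assms in auto)
  then have "((\<lambda>x. integral {- rad m c..x} ?g) has_real_derivative ?g z) (at z)"
    using assms by (simp add: at_within_Icc_at)
  then show ?thesis unfolding Psi_def by (auto intro!: derivative_eq_intros)
qed

lemma isCont_Psi: "\<bar>z\<bar> < rad m c \<Longrightarrow> isCont (Psi m c) z"
  using Psi_deriv DERIV_isCont by blast

lemma Psi_strict_mono:
  assumes "0 \<le> u" "u < v" "v < rad m c"
  shows "Psi m c u < Psi m c v"
proof (rule DERIV_pos_imp_increasing_open[OF assms(2)])
  fix z assume "u < z" "z < v"
  then have "\<bar>z\<bar> < rad m c" "z / (1 - m * z + c * z\<^sup>2) > 0"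
    using assms denominator_ge_half[of z m c] by auto
  then show "\<exists>d. (Psi m c has_real_derivative d) (at z) \<and> 0 < d"
    using Psi_deriv by blast
next
  show "continuous_on {u..v} (Psi m c)"
    using assms by (intro continuous_at_imp_continuous_on ballI isCont_Psi) auto
qed

lemma Psi_pos: "0 < z \<Longrightarrow> z < rad m c \<Longrightarrow> Psi m c z > 0"
  using Psi_strict_mono[of 0 z m c] by simp

lemma Psi_nonneg: "0 \<le> z \<Longrightarrow> z < rad m c \<Longrightarrow> Psi m c z \<ge> 0"
  using Psi_pos[of z m c] by (cases "z = 0") auto

lemma eventually_at_right_rad: "\<forall>\<^sub>F z in at_right 0. 0 < z \<and> z < rad m c"
  using rad_pos[of m c] by (auto simp: eventually_at_right_field)

lemma Psi_over_square: "((\<lambda>z. Psi m c z / z\<^sup>2) \<longlongrightarrow> 1/2) (at_right 0)"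
proof (rule lhopital_right_0)
  show "(Psi m c \<longlongrightarrow> 0) (at_right 0)"
    using isCont_Psi[of 0 m c] rad_pos[of m c] by (auto simp: isCont_def intro: tendsto_within_subset)
  show "((\<lambda>z::real. z\<^sup>2) \<longlongrightarrow> 0) (at_right 0)"
    by (auto intro!: tendsto_eq_intros)
  show "\<forall>\<^sub>F z in at_right 0. (Psi m c has_real_derivative z / (1 - m * z + c * z\<^sup>2)) (at z)"
    using eventually_at_right_rad[of m c] by eventually_elim (auto intro: Psi_deriv)
  show "\<forall>\<^sub>F z::real in at_right 0. ((\<lambda>z. z\<^sup>2) has_real_derivative 2 * z) (at z)"
    by (auto intro!: derivative_eq_intros always_eventually)
  show "\<forall>\<^sub>F z::real in at_right 0. z\<^sup>2 \<noteq> 0" "\<forall>\<^sub>F z::real in at_right 0. 2 * z \<noteq> 0"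
    by (auto simp: eventually_at_right_field intro: exI[of _ 1])
  have "((\<lambda>z. 1 / (2 * (1 - m * z + c * z\<^sup>2))) \<longlongrightarrow> 1/2) (at_right 0)"
    by (auto intro!: tendsto_eq_intros)
  then show "((\<lambda>z. z / (1 - m * z + c * z\<^sup>2) / (2 * z)) \<longlongrightarrow> 1/2) (at_right 0)"
    by (rule Lim_transform_eventually)
       (auto simp: eventually_at_right_field intro!: exI[of _ 1])
qed

text \<open>The terms of order two cancel, and the derivative of the numerator is
  \<open>m * z\<^sup>2\<close> up to higher order. So \<open>m\<close> first shows at order three;
  this is the term that separates two systems with equal \<open>l\<close>.\<close>

lemma Psi_remainder_over_cube:
  "((\<lambda>z. (z\<^sup>2 / (1 - m * z + c * z\<^sup>2) - 2 * Psi m c z) / z ^ 3) \<longlongrightarrow> m / 3) (at_right 0)"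
proof (rule lhopital_right_0)
  have "(Psi m c \<longlongrightarrow> 0) (at_right 0)"
    using isCont_Psi[of 0 m c] rad_pos[of m c] by (auto simp: isCont_def intro: tendsto_within_subset)
  then show "((\<lambda>z. z\<^sup>2 / (1 - m * z + c * z\<^sup>2) - 2 * Psi m c z) \<longlongrightarrow> 0) (at_right 0)"
    by (auto intro!: tendsto_eq_intros)
  show "((\<lambda>z::real. z ^ 3) \<longlongrightarrow> 0) (at_right 0)"
    by (auto intro!: tendsto_eq_intros)
  show "\<forall>\<^sub>F z in at_right 0. ((\<lambda>z. z\<^sup>2 / (1 - m * z + c * z\<^sup>2) - 2 * Psi m c z)
          has_real_derivative (m * z\<^sup>2 - 2 * c * z ^ 3) / (1 - m * z + c * z\<^sup>2)\<^sup>2) (at z)"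
    using eventually_at_right_rad[of m c]
  proof eventually_elim
    case (elim z)
    then have D: "1 - m * z + c * z\<^sup>2 \<noteq> 0" and z: "\<bar>z\<bar> < rad m c"
      using denominator_ge_half[of z m c] by auto
    show ?case
      by (rule derivative_eq_intros Psi_deriv z D refl)+
         (use D in \<open>simp add: divide_simps\<close>, simp add: algebra_simps power2_eq_square power3_eq_cube)
  qed
  show "\<forall>\<^sub>F z::real in at_right 0. ((\<lambda>z. z ^ 3) has_real_derivative 3 * z\<^sup>2) (at z)"
    by (auto intro!: derivative_eq_intros always_eventually)
  show "\<forall>\<^sub>F z::real in at_right 0. z ^ 3 \<noteq> 0" "\<forall>\<^sub>F z::real in at_right 0. 3 * z\<^sup>2 \<noteq> 0"
    by (auto simp: eventually_at_right_field intro: exI[of _ 1])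
  have "((\<lambda>z. (m - 2 * c * z) / (3 * (1 - m * z + c * z\<^sup>2)\<^sup>2)) \<longlongrightarrow> m / 3) (at_right 0)"
    by (auto intro!: tendsto_eq_intros)
  then show "((\<lambda>z. (m * z\<^sup>2 - 2 * c * z ^ 3) / (1 - m * z + c * z\<^sup>2)\<^sup>2 / (3 * z\<^sup>2)) \<longlongrightarrow> m / 3) (at_right 0)"
  proof (rule Lim_transform_eventually)
    show "\<forall>\<^sub>F z in at_right 0. (m - 2 * c * z) / (3 * (1 - m * z + c * z\<^sup>2)\<^sup>2)
        = (m * z\<^sup>2 - 2 * c * z ^ 3) / (1 - m * z + c * z\<^sup>2)\<^sup>2 / (3 * z\<^sup>2)"
      using eventually_at_right_rad[of m c]
    proof eventually_elim
      case (elim z)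
      have "m * z\<^sup>2 - 2 * c * z ^ 3 = z\<^sup>2 * (m - 2 * c * z)"
        by (simp add: power2_eq_square power3_eq_cube algebra_simps)
      then show ?case using elim by simp
    qed
  qed
qed

text \<open>Two solutions at the same height have different \<open>z\<close> and are compared
  through \<open>W\<close>, so the cubic remainder has to be expressed in \<open>Psi\<close>. As
  \<open>Psi\<close> is about \<open>z\<^sup>2 / 2\<close>, the limit \<open>m / 3\<close> is
  divided by the power 3/2 of 1/2, written \<open>1/2 * sqrt (1/2)\<close>.\<close>

lemma Psi_expansion:
  assumes "\<eta> > 0"
  shows "\<forall>\<^sub>F z in at_right 0. \<bar>z\<^sup>2 / (1 - m * z + c * z\<^sup>2) - 2 * Psi m c z
      - m / 3 / (1/2 * sqrt (1/2)) * (Psi m c z * sqrt (Psi m c z))\<bar> \<le> \<eta> * (Psi m c z * sqrt (Psi m c z))"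
proof -
  let ?K = "\<lambda>z. z\<^sup>2 / (1 - m * z + c * z\<^sup>2) - 2 * Psi m c z"
  let ?P = "\<lambda>z. Psi m c z / z\<^sup>2"
  let ?\<mu> = "m / 3 / (1/2 * sqrt (1/2))"
  have "((\<lambda>z. ?K z / z ^ 3 / (?P z * sqrt (?P z))) \<longlongrightarrow> ?\<mu>) (at_right 0)"
    by (intro tendsto_divide tendsto_mult tendsto_real_sqrt Psi_over_square Psi_remainder_over_cube) simp
  then have "\<forall>\<^sub>F z in at_right 0. dist (?K z / z ^ 3 / (?P z * sqrt (?P z))) ?\<mu> < \<eta>"
    using assms by (rule tendstoD)
  then show ?thesis using eventually_at_right_rad[of m c]
  proof eventually_elim
    case (elim z)
    define Q where "Q = Psi m c z * sqrt (Psi m c z)"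
    have "Q > 0" using Psi_pos elim by (simp add: Q_def)
    have "?P z * sqrt (?P z) = Q / z ^ 3" using elim
      by (simp add: Q_def real_sqrt_divide power3_eq_cube power2_eq_square)
    then have "\<bar>?K z / Q - ?\<mu>\<bar> \<le> \<eta>" using elim by (simp add: dist_real_def)
    then have "\<bar>?K z / Q - ?\<mu>\<bar> * Q \<le> \<eta> * Q" using \<open>Q > 0\<close> by (intro mult_right_mono) auto
    also have "\<bar>?K z / Q - ?\<mu>\<bar> * Q = \<bar>(?K z / Q - ?\<mu>) * Q\<bar>" using \<open>Q > 0\<close> by (simp add: abs_mult)
    also have "(?K z / Q - ?\<mu>) * Q = ?K z - ?\<mu> * Q"
      using \<open>Q > 0\<close> by (simp only: left_diff_distrib) simp
    finally show ?case by (simp add: Q_def)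
  qed
qed

text \<open>The substitution \<open>z = x / (1 - n y)\<close> makes the equation separable when \<open>l = - n\<close>;
  otherwise \<open>Psi\<close> collects all of the right-hand side except for one term with factor \<open>l + n\<close>.\<close>

lemma half_arc_Psi_deriv:
  assumes arc: "half_arc l m n a b f" and y: "a < y" "y < b" "y < 1" "n * y < 1"
    and z: "z = f y / (1 - n * y)" "\<bar>z\<bar> < rad m (n * (1 - n))"
  shows "((\<lambda>y. Psi m (n * (1 - n)) (f y / (1 - n * y))) has_real_derivative
      - (y / (1 - (1 + n) * y + n * y\<^sup>2))
      + (l + n) * (z\<^sup>2 / (1 - m * z + n * (1 - n) * z\<^sup>2)) / (1 - y)) (at y)"
proof -
  have fy: "f y > 0"
    and der: "(f has_real_derivative (- y + l * (f y)\<^sup>2 + m * f y * y + n * y\<^sup>2) / (f y * (1 - y))) (at y)"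
    using arc y by (auto simp: half_arc_def)
  define q p D where "q = 1 - n * y" and "p = 1 - y" and "D = 1 - m * z + n * (1 - n) * z\<^sup>2"
  have pos: "q > 0" "p > 0" "D > 0" "z > 0" "f y = z * q"
  proof -
    show "q > 0" "p > 0" using y by (auto simp: q_def p_def)
    then show "z > 0" "f y = z * q" using fy unfolding z(1) q_def by auto
    show "D > 0" using denominator_ge_half[of z m "n * (1 - n)"] z(2) unfolding D_def by linarith
  qed
  define d where "d = (((- y + l * (f y)\<^sup>2 + m * f y * y + n * y\<^sup>2) / (f y * (1 - y))) * q
      - f y * (- n)) / (q * q)"
  have "((\<lambda>y. f y / (1 - n * y)) has_real_derivative d) (at y)"
    unfolding d_def q_def
    by (rule derivative_eq_intros der refl)+ (use pos q_def in auto)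
  from DERIV_chain2[OF Psi_deriv[of "f y / (1 - n * y)" m "n * (1 - n)"] this]
  have main: "((\<lambda>y. Psi m (n * (1 - n)) (f y / (1 - n * y))) has_real_derivative z / D * d) (at y)"
    using z by (simp add: D_def)
  \<comment> \<open>Here \<open>d\<close> is the derivative of the quotient \<open>z\<close>. The
    identity rests on \<open>n * (1 - y) = n * (1 - n * y) - n * (1 - n) * y\<close>, which is the
    origin of the coefficient \<open>n * (1 - n)\<close>. All of \<open>m\<close> is absorbed into
    \<open>D\<close>, so after division by \<open>D\<close> the first term depends on
    \<open>y\<close> and \<open>n\<close> only.\<close>
  have zd: "z * d * (q * p) = - y * D + (l + n) * z\<^sup>2 * q"
  proof -
    have "z * d * (q * p) = ((- y + l * (f y)\<^sup>2 + m * f y * y + n * y\<^sup>2) * q + n * (f y)\<^sup>2 * p) / (q * q)"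
      using pos unfolding d_def p_def[symmetric]
      by (simp add: divide_simps) (simp add: algebra_simps power2_eq_square)
    also have "(- y + l * (f y)\<^sup>2 + m * f y * y + n * y\<^sup>2) * q + n * (f y)\<^sup>2 * p
        = (- y * D + (l + n) * z\<^sup>2 * q) * (q * q)"
      unfolding pos(5) D_def p_def q_def by algebra
    finally show ?thesis using pos by simp
  qed
  have "z / D * d = z * d * (q * p) / (D * (q * p))" using pos by simp
  also have "\<dots> = - (y / (q * p)) + (l + n) * (z\<^sup>2 / D) / p"
    unfolding zd using pos by (simp add: field_simps)
  also have "q * p = 1 - (1 + n) * y + n * y\<^sup>2"
    by (simp add: q_def p_def algebra_simps power2_eq_square)
  finally show ?thesis using main by (simp add: D_def p_def)
qed

section \<open>Comparison of two half-arcs\<close>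

text \<open>In the square roots \<open>s\<close> and \<open>t\<close> this is a difference of cubes,
  that is \<open>s - t\<close> times a factor of at most \<open>(s + t) * (s + t)\<close>. The bound
  1/4 gives \<open>s + t \<le> 1\<close>, which makes the constant 1.\<close>

lemma sqrt_cube_Lipschitz:
  assumes "0 \<le> u" "u \<le> 1/4" "0 \<le> v" "v \<le> 1/4"
  shows "\<bar>u * sqrt u - v * sqrt v\<bar> \<le> \<bar>u - v\<bar>"
proof -
  define s t where "s = sqrt u" and "t = sqrt v"
  have st: "0 \<le> s" "s \<le> 1/2" "0 \<le> t" "t \<le> 1/2" "u = s * s" "v = t * t"
    using assms real_sqrt_le_mono[of u "1/4"] real_sqrt_le_mono[of v "1/4"]
    by (auto simp: s_def t_def real_sqrt_divide)
  have "u * sqrt u = s * s * s" "v * sqrt v = t * t * t"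
    using st by (auto simp flip: s_def t_def)
  then have "u * sqrt u - v * sqrt v = (s - t) * (s * s + s * t + t * t)" by algebra
  then have "\<bar>u * sqrt u - v * sqrt v\<bar> = \<bar>s - t\<bar> * (s * s + s * t + t * t)"
    using st by (simp add: abs_mult)
  also have "s * s + s * t + t * t \<le> (s + t) * (s + t)" using st by (simp add: algebra_simps)
  also have "\<dots> \<le> (s + t) * 1" using st by (intro mult_left_mono) auto
  finally have "\<bar>u * sqrt u - v * sqrt v\<bar> \<le> \<bar>s - t\<bar> * (s + t)" by (simp add: mult_left_mono)
  also have "\<dots> = \<bar>(s - t) * (s + t)\<bar>" using st by (simp add: abs_mult)
  also have "(s - t) * (s + t) = u - v" unfolding st(5,6) by algebra
  finally show ?thesis .
qed

definition kfun :: "real \<Rightarrow> real \<Rightarrow> real \<Rightarrow> real" where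
  "kfun m c z = z\<^sup>2 / (1 - m * z + c * z\<^sup>2)"

lemma eventually_pair_at_right:
  fixes P Q :: "real \<Rightarrow> bool"
  assumes "\<forall>\<^sub>F z in at_right 0. P z" "\<forall>\<^sub>F z in at_right 0. Q z"
  obtains \<rho> where "\<rho> > 0" "\<And>z. 0 < z \<Longrightarrow> z < \<rho> \<Longrightarrow> P z \<and> Q z"
  using eventually_conj[OF assms] by (auto simp: eventually_at_right_field)

lemma Psi_small: "e > 0 \<Longrightarrow> \<forall>\<^sub>F z in at_right 0. Psi m c z < e"
  using isCont_Psi[of 0 m c] rad_pos[of m c]
  by (auto simp: isCont_def intro!: order_tendstoD(2) intro: tendsto_within_subset)

text \<open>The lower bound that \<open>DERIV_superlinear_no_return\<close> requires of the difference of two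
  solutions; \<open>d\<^sub>i\<close> stands for \<open>l\<^sub>i + n\<close>.\<close>

lemma kfun_compare:
  assumes "d1 > d2 \<or> d1 = d2 \<and> d1 * (m1 - m2) > 0"
  obtains \<rho> L where "\<rho> > 0" "L \<ge> 0" "\<rho> \<le> rad m1 c" "\<rho> \<le> rad m2 c"
    "\<And>z1 z2. 0 \<le> z1 \<Longrightarrow> z1 < \<rho> \<Longrightarrow> 0 < z2 \<Longrightarrow> z2 < \<rho> \<Longrightarrow>
       d1 * kfun m1 c z1 - d2 * kfun m2 c z2 > - L * \<bar>Psi m1 c z1 - Psi m2 c z2\<bar>"
proof -
  define \<kappa> where "\<kappa> = (\<lambda>m::real. m / 3 / (1/2 * sqrt (1/2)))"
  define X where "X = (\<lambda>w. w * sqrt w)"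
  define A where "A = \<bar>d1\<bar> + \<bar>d2\<bar>"
  define \<Delta> where "\<Delta> = d1 * \<kappa> m1 - d2 * \<kappa> m2"
  \<comment> \<open>The gain of the first system over the second at equal \<open>W = w\<close> has
    to beat the remainders, which amount to \<open>\<eta> * A * X w\<close>. If
    \<open>d1 > d2\<close>, the linear term dominates every multiple of \<open>w * sqrt w\<close>
    for small \<open>w\<close>, and \<open>\<eta> = 1\<close> is good enough; if
    \<open>d1 = d2\<close>, only \<open>\<Delta> * X w\<close> is left and \<open>\<eta>\<close>
    must be small compared with \<open>\<Delta>\<close>.\<close>
  have "\<exists>\<eta> e. \<eta> > 0 \<and> \<eta> \<le> 1 \<and> 0 < e \<and> e \<le> 1/4 \<and> (\<forall>w. 0 < w \<longrightarrow> w < e \<longrightarrow> 2 * (d1 - d2) * w + \<Delta> * X w - \<eta> * A * X w > 0)"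
  proof (cases "d1 > d2")
    case True
    define M where "M = \<bar>\<Delta>\<bar> + A + 1"
    have "M > 0" "A \<ge> 0" by (auto simp: M_def A_def intro: add_nonneg_pos)
    define e where "e = min (1/4) (((d1 - d2) / M)\<^sup>2)"
    have "2 * (d1 - d2) * w + \<Delta> * X w - 1 * A * X w > 0" if w: "0 < w" "w < e" for w
    proof -
      have "sqrt w < (d1 - d2) / M"
        using w True \<open>M > 0\<close> by (intro real_less_lsqrt) (auto simp: e_def)
      then have "M * sqrt w < d1 - d2" using \<open>M > 0\<close> by (simp add: field_simps)
      then have "w * (M * sqrt w) < w * (d1 - d2)" using w by simp
      moreover have "(A - \<Delta>) * X w \<le> M * X w" using w
        by (intro mult_right_mono) (auto simp: M_def X_def)
      moreover have "w * (d1 - d2) > 0" using w True by simp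
      ultimately show ?thesis by (simp add: X_def algebra_simps)
    qed
    moreover have "e > 0" "e \<le> 1/4" using True \<open>M > 0\<close> by (auto simp: e_def)
    ultimately show ?thesis by (intro exI[of _ 1] exI[of _ e]) auto
  next
    case False
    then have d: "d1 = d2" "d1 * (m1 - m2) > 0" using assms by auto
    have "\<Delta> = d1 * (m1 - m2) * (1 / 3 / (1/2 * sqrt (1/2)))"
      by (simp add: \<Delta>_def \<kappa>_def d diff_divide_distrib algebra_simps)
    then have "\<Delta> > 0" using d by simp
    have "A \<ge> 0" by (auto simp: A_def)
    define \<eta> where "\<eta> = min 1 (\<Delta> / (2 * (A + 1)))"
    have "\<eta> * A \<le> \<Delta> / (2 * (A + 1)) * (A + 1)"
      using \<open>A \<ge> 0\<close> \<open>\<Delta> > 0\<close> by (intro mult_mono) (auto simp: \<eta>_def)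
    also have "\<dots> < \<Delta>" using \<open>A \<ge> 0\<close> \<open>\<Delta> > 0\<close> by (simp add: field_simps add_pos_nonneg)
    finally have "\<eta> * A < \<Delta>" .
    then have "2 * (d1 - d2) * w + \<Delta> * X w - \<eta> * A * X w > 0" if "0 < w" for w
      using that mult_strict_right_mono[of "\<eta> * A" \<Delta> "X w"] by (simp add: d X_def)
    moreover have "\<eta> > 0" "\<eta> \<le> 1" using \<open>A \<ge> 0\<close> \<open>\<Delta> > 0\<close> by (auto simp: \<eta>_def)
    ultimately show ?thesis by (intro exI[of _ \<eta>] exI[of _ "1/4"]) auto
  qed
  then obtain \<eta> e where \<eta>: "\<eta> > 0" "\<eta> \<le> 1" "0 < e" "e \<le> 1/4"
    and main: "\<And>w. 0 < w \<Longrightarrow> w < e \<Longrightarrow> 2 * (d1 - d2) * w + \<Delta> * X w - \<eta> * A * X w > 0" by blast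
  define good where "good = (\<lambda>m z. \<bar>kfun m c z - 2 * Psi m c z - \<kappa> m * X (Psi m c z)\<bar> \<le> \<eta> * X (Psi m c z)
      \<and> z < rad m c \<and> Psi m c z < e)"
  have ev: "\<forall>\<^sub>F z in at_right 0. good m z" for m
    using Psi_expansion[OF \<eta>(1), of m c] eventually_at_right_rad[of m c] Psi_small[OF \<eta>(3), of m c]
    unfolding good_def \<kappa>_def X_def kfun_def by eventually_elim auto
  obtain \<rho>0 where \<rho>0: "\<rho>0 > 0" "\<And>z. 0 < z \<Longrightarrow> z < \<rho>0 \<Longrightarrow> good m1 z \<and> good m2 z"
    using eventually_pair_at_right[OF ev ev] by blast
  define \<rho> where "\<rho> = min \<rho>0 (min (rad m1 c) (rad m2 c))"
  define L where "L = 2 * \<bar>d1\<bar> + \<bar>d1 * \<kappa> m1\<bar> + A"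
  show ?thesis
  proof
    show "\<rho> > 0" "\<rho> \<le> rad m1 c" "\<rho> \<le> rad m2 c" using \<rho>0 rad_pos by (auto simp: \<rho>_def)
    show "L \<ge> 0" by (simp add: L_def A_def)
    fix z1 z2 assume z: "0 \<le> z1" "z1 < \<rho>" "0 < z2" "z2 < \<rho>"
    define w1 w2 where "w1 = Psi m1 c z1" and "w2 = Psi m2 c z2"
    have g1: "\<bar>kfun m1 c z1 - 2 * w1 - \<kappa> m1 * X w1\<bar> \<le> \<eta> * X w1 \<and> w1 < e"
      using \<rho>0(2)[of z1] z \<eta> by (cases "z1 = 0") (auto simp: \<rho>_def good_def w1_def kfun_def X_def)
    have g2: "\<bar>kfun m2 c z2 - 2 * w2 - \<kappa> m2 * X w2\<bar> \<le> \<eta> * X w2 \<and> w2 < e"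
      using \<rho>0(2)[of z2] z by (auto simp: \<rho>_def good_def w2_def)
    have w: "0 \<le> w1" "0 < w2" using z Psi_nonneg Psi_pos by (auto simp: w1_def w2_def \<rho>_def)
    define R1 R2 where "R1 = kfun m1 c z1 - 2 * w1 - \<kappa> m1 * X w1"
      and "R2 = kfun m2 c z2 - 2 * w2 - \<kappa> m2 * X w2"
    have XL: "\<bar>X w1 - X w2\<bar> \<le> \<bar>w1 - w2\<bar>"
      unfolding X_def by (rule sqrt_cube_Lipschitz) (use w g1 g2 \<eta> in auto)
    \<comment> \<open>The remainder of the first solution is controlled by \<open>X w1\<close>; it
      is moved to \<open>X w2\<close> at the cost of \<open>\<bar>w1 - w2\<bar>\<close>. The strict
      gain is thus taken at \<open>w2\<close>, which is positive, while \<open>w1\<close> may be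
      0.\<close>
    have "\<bar>R1\<bar> \<le> \<eta> * X w2 + \<bar>w1 - w2\<bar>"
    proof -
      have "\<eta> * X w1 \<le> \<eta> * (X w2 + \<bar>w1 - w2\<bar>)" using XL \<eta> by (intro mult_left_mono) auto
      moreover have "\<eta> * \<bar>w1 - w2\<bar> \<le> \<bar>w1 - w2\<bar>" using \<eta> by (simp add: mult_left_le_one_le)
      ultimately show ?thesis using g1 by (simp add: R1_def algebra_simps)
    qed
    then have "\<bar>d1 * R1\<bar> \<le> \<bar>d1\<bar> * (\<eta> * X w2 + \<bar>w1 - w2\<bar>)"
      unfolding abs_mult by (intro mult_left_mono) auto
    moreover have "\<bar>d2 * R2\<bar> \<le> \<bar>d2\<bar> * (\<eta> * X w2 + \<bar>w1 - w2\<bar>)"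
      unfolding abs_mult using g2 by (intro mult_left_mono) (auto simp: R2_def)
    ultimately have R: "\<bar>d1 * R1 - d2 * R2\<bar> \<le> A * (\<eta> * X w2 + \<bar>w1 - w2\<bar>)"
      using abs_triangle_ineq4[of "d1 * R1" "d2 * R2"] unfolding A_def distrib_right by linarith
    have "\<bar>2 * d1 * (w1 - w2)\<bar> \<le> 2 * \<bar>d1\<bar> * \<bar>w1 - w2\<bar>" by (simp add: abs_mult)
    moreover have "\<bar>d1 * \<kappa> m1 * (X w1 - X w2)\<bar> \<le> \<bar>d1 * \<kappa> m1\<bar> * \<bar>w1 - w2\<bar>"
      unfolding abs_mult[of "d1 * \<kappa> m1"] using XL by (intro mult_left_mono) auto
    \<comment> \<open>The terms with \<open>w1 - w2\<close> and \<open>X w1 - X w2\<close> go into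
      \<open>L\<close>, the remainders partly into \<open>L\<close> and partly against the last
      bracket, which is the gain at \<open>w2\<close>.\<close>
    moreover have "d1 * kfun m1 c z1 - d2 * kfun m2 c z2 = 2 * d1 * (w1 - w2) + d1 * \<kappa> m1 * (X w1 - X w2)
        + (d1 * R1 - d2 * R2) + (2 * (d1 - d2) * w2 + \<Delta> * X w2)"
      by (simp add: R1_def R2_def \<Delta>_def algebra_simps)
    moreover have "2 * (d1 - d2) * w2 + \<Delta> * X w2 - \<eta> * A * X w2 > 0" using main w g2 by blast
    moreover have "A * (\<eta> * X w2 + \<bar>w1 - w2\<bar>) = \<eta> * A * X w2 + A * \<bar>w1 - w2\<bar>" by (simp add: algebra_simps)
    moreover have "L * \<bar>w1 - w2\<bar> = 2 * \<bar>d1\<bar> * \<bar>w1 - w2\<bar> + \<bar>d1 * \<kappa> m1\<bar> * \<bar>w1 - w2\<bar> + A * \<bar>w1 - w2\<bar>"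
      by (simp add: L_def algebra_simps)
    ultimately show "d1 * kfun m1 c z1 - d2 * kfun m2 c z2 > - L * \<bar>Psi m1 c z1 - Psi m2 c z2\<bar>"
      using R unfolding w1_def[symmetric] w2_def[symmetric] by (simp add: abs_le_iff)
  qed
qed

lemma small_denominator:
  assumes "\<bar>y\<bar> < 1 / (2 * (1 + \<bar>n\<bar>))"
  shows "1 - n * y > (1/2 :: real)" "y < 1/2" "-1/2 < y"
proof -
  have "\<bar>n * y\<bar> \<le> (1 + \<bar>n\<bar>) * \<bar>y\<bar>" by (simp add: abs_mult algebra_simps)
  also have "\<dots> < 1/2" using assms by (simp add: field_simps)
  finally show "1 - n * y > 1/2" by linarith
  have "1 / (2 * (1 + \<bar>n\<bar>)) \<le> 1/2" by (simp add: divide_simps)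
  then show "y < 1/2" "-1/2 < y" using assms by linarith+
qed

lemma small_quotient:
  assumes "1 - n * y > (1/2 :: real)" "0 \<le> x" "x < \<rho> / 2"
  shows "0 \<le> x / (1 - n * y)" "x / (1 - n * y) < \<rho>"
proof -
  show "0 \<le> x / (1 - n * y)" using assms by simp
  have "\<rho> * (1/2) \<le> \<rho> * (1 - n * y)" using assms by (intro mult_left_mono) auto
  then show "x / (1 - n * y) < \<rho>"
    using assms by (subst pos_divide_less_eq) linarith+
qed

text \<open>At \<open>a2\<close> the second arc has \<open>W = 0\<close>, so the difference
  \<open>D\<close> of the two values of \<open>W\<close> is nonnegative there; the larger growth of
  the first arc then forbids that both vanish at \<open>b\<close>. Only \<open>a2\<close> and
  \<open>b\<close> are required to be near 0, while \<open>a1\<close> may be far below.\<close>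

lemma half_arcs_no_common_end:
  assumes "l1 > l2 \<or> l1 = l2 \<and> (l1 + n) * (m1 - m2) > 0"
  obtains \<epsilon> where "\<epsilon> > 0"
    "\<And>a1 a2 b f1 f2. half_arc l1 m1 n a1 b f1 \<Longrightarrow> half_arc l2 m2 n a2 b f2 \<Longrightarrow>
       a1 \<le> a2 \<Longrightarrow> - \<epsilon> < a2 \<Longrightarrow> a2 < 0 \<Longrightarrow> 0 < b \<Longrightarrow> b < \<epsilon> \<Longrightarrow> False"
proof -
  define c where "c = n * (1 - n)"
  have "l1 + n > l2 + n \<or> l1 + n = l2 + n \<and> (l1 + n) * (m1 - m2) > 0" using assms by auto
  then obtain \<rho> L where \<rho>: "\<rho> > 0" "L \<ge> 0" "\<rho> \<le> rad m1 c" "\<rho> \<le> rad m2 c"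
    and cmp: "\<And>z1 z2. 0 \<le> z1 \<Longrightarrow> z1 < \<rho> \<Longrightarrow> 0 < z2 \<Longrightarrow> z2 < \<rho> \<Longrightarrow>
       (l1 + n) * kfun m1 c z1 - (l2 + n) * kfun m2 c z2 > - L * \<bar>Psi m1 c z1 - Psi m2 c z2\<bar>"
    by (rule kfun_compare) blast
  obtain \<epsilon>1 where \<epsilon>1: "0 < \<epsilon>1" "\<epsilon>1 \<le> 1/2"
    "\<And>a b f y1 y2. half_arc l1 m1 n a b f \<Longrightarrow> y1 \<in> {a..b} \<Longrightarrow> y2 \<in> {a..b} \<Longrightarrow> f y2 = 0 \<Longrightarrow>
       \<bar>y1\<bar> \<le> 1/2 \<Longrightarrow> \<bar>y2\<bar> < \<epsilon>1 \<Longrightarrow> \<bar>f y1\<bar> < \<rho> / 2 \<and> \<bar>y1\<bar> < \<rho> / 2"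
    using half_arc_small[of "\<rho> / 2" l1 m1 n] \<rho> by auto
  obtain \<epsilon>2 where \<epsilon>2: "0 < \<epsilon>2" "\<epsilon>2 \<le> 1/2"
    "\<And>a b f y1 y2. half_arc l2 m2 n a b f \<Longrightarrow> y1 \<in> {a..b} \<Longrightarrow> y2 \<in> {a..b} \<Longrightarrow> f y2 = 0 \<Longrightarrow>
       \<bar>y1\<bar> \<le> 1/2 \<Longrightarrow> \<bar>y2\<bar> < \<epsilon>2 \<Longrightarrow> \<bar>f y1\<bar> < \<rho> / 2 \<and> \<bar>y1\<bar> < \<rho> / 2"
    using half_arc_small[of "\<rho> / 2" l2 m2 n] \<rho> by auto
  define \<epsilon> where "\<epsilon> = min (1 / (2 * (1 + \<bar>n\<bar>))) (min \<epsilon>1 \<epsilon>2)"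
  show ?thesis
  proof
    show "\<epsilon> > 0" using \<epsilon>1 \<epsilon>2 by (simp add: \<epsilon>_def add_pos_nonneg)
    fix a1 a2 b f1 f2
    assume arc1: "half_arc l1 m1 n a1 b f1" and arc2: "half_arc l2 m2 n a2 b f2"
      and a: "a1 \<le> a2" "- \<epsilon> < a2" "a2 < 0" "0 < b" "b < \<epsilon>"
    define z1 z2 where "z1 = (\<lambda>y. f1 y / (1 - n * y))" and "z2 = (\<lambda>y. f2 y / (1 - n * y))"
    have y_small: "1 - n * y > 1/2 \<and> y < 1/2 \<and> -1/2 < y" if "y \<in> {a2..b}" for y
    proof -
      have "\<bar>y\<bar> < 1 / (2 * (1 + \<bar>n\<bar>))" using that a by (auto simp: \<epsilon>_def)
      then show ?thesis using small_denominator by blast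
    qed
    have zs: "0 \<le> z1 y" "z1 y < \<rho>" "0 \<le> z2 y" "z2 y < \<rho>" if y: "y \<in> {a2..b}" for y
    proof -
      have "\<bar>f1 y\<bar> < \<rho> / 2" using \<epsilon>1(3)[OF arc1, of y b] y y_small[OF y] a arc1
        by (auto simp: \<epsilon>_def half_arc_def)
      moreover have "\<bar>f2 y\<bar> < \<rho> / 2" using \<epsilon>2(3)[OF arc2, of y b] y y_small[OF y] a arc2
        by (auto simp: \<epsilon>_def half_arc_def)
      moreover have "f1 y \<ge> 0" "f2 y \<ge> 0"
        using half_arc_nonneg[OF arc1] half_arc_nonneg[OF arc2] y a by auto
      ultimately show "0 \<le> z1 y" "z1 y < \<rho>" "0 \<le> z2 y" "z2 y < \<rho>"
        using small_quotient[of n y _ \<rho>] y_small[OF y] by (auto simp: z1_def z2_def)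
    qed
    define D where "D = (\<lambda>y. Psi m1 c (z1 y) - Psi m2 c (z2 y))"
    define G where "G = (\<lambda>y. (l1 + n) * kfun m1 c (z1 y) - (l2 + n) * kfun m2 c (z2 y))"
    have contz: "continuous_on {a2..b} z1" "continuous_on {a2..b} z2"
    proof -
      have "continuous_on {a2..b} f1" "continuous_on {a2..b} f2"
        using arc1 arc2 a by (auto simp: half_arc_def intro: continuous_on_subset)
      then show "continuous_on {a2..b} z1" "continuous_on {a2..b} z2"
        unfolding z1_def z2_def by (intro continuous_intros ballI; use y_small in force)+
    qed
    have contPsi: "continuous_on {0..<\<rho>} (Psi m1 c)" "continuous_on {0..<\<rho>} (Psi m2 c)"
      using \<rho> by (auto intro!: continuous_at_imp_continuous_on isCont_Psi)
    show False
    \<comment> \<open>In this range \<open>1 / (1 - y)\<close> is less than 2, which turns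
      \<open>L\<close> into \<open>2 * L\<close>.\<close>
    proof (rule DERIV_superlinear_no_return[of a2 b D "\<lambda>y. G y / (1 - y)" "2 * L"])
      show "a2 < b" using a by simp
      show "continuous_on {a2..b} D" unfolding D_def
        using zs by (intro continuous_intros continuous_on_compose2[OF contPsi(1) contz(1)]
            continuous_on_compose2[OF contPsi(2) contz(2)]) auto
      show "D a2 \<ge> 0"
      proof -
        have "z2 a2 = 0" using arc2 by (simp add: z2_def half_arc_def)
        then show ?thesis using Psi_nonneg[of "z1 a2" m1 c] zs[of a2] a \<rho> by (simp add: D_def)
      qed
      have "z1 b = 0" "z2 b = 0" using arc1 arc2 by (auto simp: z1_def z2_def half_arc_def)
      then show "D b \<le> 0" by (simp add: D_def)
      fix y assume y: "a2 < y" "y < b"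
      then have y': "y \<in> {a2..b}" by simp
      note small = y_small[OF y'] zs[OF y']
      have d1: "((\<lambda>y. Psi m1 c (z1 y)) has_real_derivative
        - (y / (1 - (1 + n) * y + n * y\<^sup>2)) + (l1 + n) * kfun m1 c (z1 y) / (1 - y)) (at y)"
        unfolding z1_def kfun_def c_def
        by (rule half_arc_Psi_deriv[OF arc1]) (use small y a \<rho> in \<open>auto simp: z1_def c_def\<close>)
      have d2: "((\<lambda>y. Psi m2 c (z2 y)) has_real_derivative
        - (y / (1 - (1 + n) * y + n * y\<^sup>2)) + (l2 + n) * kfun m2 c (z2 y) / (1 - y)) (at y)"
        unfolding z2_def kfun_def c_def
        by (rule half_arc_Psi_deriv[OF arc2]) (use small y a \<rho> in \<open>auto simp: z2_def c_def\<close>)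
      have "(D has_real_derivative (- (y / (1 - (1 + n) * y + n * y\<^sup>2)) + (l1 + n) * kfun m1 c (z1 y) / (1 - y))
          - (- (y / (1 - (1 + n) * y + n * y\<^sup>2)) + (l2 + n) * kfun m2 c (z2 y) / (1 - y))) (at y)"
        unfolding D_def by (rule DERIV_diff[OF d1 d2])
      then show "(D has_real_derivative G y / (1 - y)) (at y)"
        by (simp add: G_def diff_divide_distrib)
      have "f2 y > 0" using arc2 y by (auto simp: half_arc_def)
      then have "z2 y > 0" using small by (simp add: z2_def)
      then have "G y > - L * \<bar>D y\<bar>" using cmp[of "z1 y" "z2 y"] small by (simp add: G_def D_def)
      then have "G y / (1 - y) > - L * \<bar>D y\<bar> / (1 - y)"
        using small by (intro divide_strict_right_mono) auto
      moreover have "L * \<bar>D y\<bar> / (1 - y) \<le> L * \<bar>D y\<bar> / (1/2)"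
        using small \<rho> by (intro divide_left_mono) auto
      ultimately show "G y / (1 - y) > - (2 * L) * \<bar>D y\<bar>" by simp
    qed
  qed
qed

text \<open>With \<open>l = - n\<close> the term containing \<open>K\<close> drops out, so
  \<open>Psi m c (z y) + Psi (1 + n) n y\<close> is constant along the arc, and \<open>z\<close>
  vanishes at both ends. The resulting relation between \<open>a\<close> and \<open>b\<close> is the
  same for every \<open>m\<close>.\<close>

lemma half_arc_first_integral:
  obtains \<epsilon> where "\<epsilon> > 0"
    "\<And>a b f. half_arc (- n) m n a b f \<Longrightarrow> - \<epsilon> < a \<Longrightarrow> a < \<epsilon> \<Longrightarrow> b < \<epsilon> \<Longrightarrow>
       Psi (1 + n) n a = Psi (1 + n) n b"
proof -
  define c where "c = n * (1 - n)"
  define \<rho> where "\<rho> = rad m c"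
  have "\<rho> > 0" by (simp add: \<rho>_def rad_pos)
  obtain \<epsilon>1 where \<epsilon>1: "0 < \<epsilon>1" "\<epsilon>1 \<le> 1/2"
    "\<And>a b f y1 y2. half_arc (- n) m n a b f \<Longrightarrow> y1 \<in> {a..b} \<Longrightarrow> y2 \<in> {a..b} \<Longrightarrow> f y2 = 0 \<Longrightarrow>
       \<bar>y1\<bar> \<le> 1/2 \<Longrightarrow> \<bar>y2\<bar> < \<epsilon>1 \<Longrightarrow> \<bar>f y1\<bar> < \<rho> / 2 \<and> \<bar>y1\<bar> < \<rho> / 2"
    using half_arc_small[of "\<rho> / 2" "- n" m n] \<open>\<rho> > 0\<close> by auto
  define \<epsilon> where "\<epsilon> = min (rad (1 + n) n) (min (1 / (2 * (1 + \<bar>n\<bar>))) \<epsilon>1)"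
  show ?thesis
  proof
    show "\<epsilon> > 0" using \<epsilon>1 rad_pos by (simp add: \<epsilon>_def add_pos_nonneg)
    fix a b f assume arc: "half_arc (- n) m n a b f" and a: "- \<epsilon> < a" "a < \<epsilon>" "b < \<epsilon>"
    define z where "z = (\<lambda>y. f y / (1 - n * y))"
    have y_small: "1 - n * y > 1/2 \<and> y < 1/2 \<and> -1/2 < y \<and> \<bar>y\<bar> < rad (1 + n) n" if "y \<in> {a..b}" for y
    proof -
      have "\<bar>y\<bar> < 1 / (2 * (1 + \<bar>n\<bar>))" "\<bar>y\<bar> < rad (1 + n) n" using that a by (auto simp: \<epsilon>_def)
      then show ?thesis using small_denominator by blast
    qed
    have zs: "0 \<le> z y" "z y < \<rho>" if y: "y \<in> {a..b}" for y
    proof -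
      have "\<bar>f y\<bar> < \<rho> / 2" using \<epsilon>1(3)[OF arc, of y a] y y_small[OF y] a arc
        by (auto simp: \<epsilon>_def half_arc_def)
      moreover have "f y \<ge> 0" using half_arc_nonneg[OF arc] y by auto
      ultimately show "0 \<le> z y" "z y < \<rho>"
        using small_quotient[of n y _ \<rho>] y_small[OF y] by (auto simp: z_def)
    qed
    have contz: "continuous_on {a..b} z"
      unfolding z_def using arc by (intro continuous_intros ballI) (use y_small in \<open>force simp: half_arc_def\<close>)+
    have contPsi: "continuous_on {0..<\<rho>} (Psi m c)"
      by (auto simp: \<rho>_def intro!: continuous_at_imp_continuous_on isCont_Psi)
    have "Psi m c (z b) + Psi (1 + n) n b = Psi m c (z a) + Psi (1 + n) n a"
    proof (rule DERIV_isconst_end[of a b "\<lambda>y. Psi m c (z y) + Psi (1 + n) n y"])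
      show "a < b" using arc by (simp add: half_arc_def)
      have "continuous_on {a..b} (Psi (1 + n) n)"
        using y_small by (intro continuous_at_imp_continuous_on ballI isCont_Psi) auto
      then show "continuous_on {a..b} (\<lambda>y. Psi m c (z y) + Psi (1 + n) n y)"
        using zs by (intro continuous_intros continuous_on_compose2[OF contPsi contz]) auto
      fix y assume y: "a < y" "y < b"
      then have y': "y \<in> {a..b}" by simp
      note small = y_small[OF y'] zs[OF y']
      have "((\<lambda>y. Psi m c (z y)) has_real_derivative
        - (y / (1 - (1 + n) * y + n * y\<^sup>2)) + (- n + n) * kfun m c (z y) / (1 - y)) (at y)"
        unfolding z_def kfun_def c_def
        by (rule half_arc_Psi_deriv[OF arc]) (use small y a in \<open>auto simp: z_def c_def \<rho>_def\<close>)
      from DERIV_add[OF this Psi_deriv[of y "1 + n" n]]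
      show "((\<lambda>y. Psi m c (z y) + Psi (1 + n) n y) has_real_derivative 0) (at y)"
        using small by simp
    qed
    moreover have "z a = 0" "z b = 0" using arc by (auto simp: z_def half_arc_def)
    ultimately show "Psi (1 + n) n a = Psi (1 + n) n b" by simp
  qed
qed

section \<open>Orbit arcs in the right half-plane\<close>

definition right_arc ::
    "real \<Rightarrow> real \<Rightarrow> real \<Rightarrow> real \<Rightarrow> real \<Rightarrow> (real \<Rightarrow> real \<times> real) \<Rightarrow> real \<Rightarrow> real \<Rightarrow> bool" where
  "right_arc l m n a b \<gamma> s0 s1 \<longleftrightarrow> s0 < s1 \<and> continuous_on {s0..s1} \<gamma> \<and> \<gamma> s0 = (0, a) \<and> \<gamma> s1 = (0, b)
     \<and> right_orbit_on (quad_field l m n) \<gamma> {s0<..<s1}"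

lemma quad_orbit_components:
  assumes "(\<gamma> has_vector_derivative quad_field l m n (\<gamma> s)) (at s)"
  shows "((\<lambda>s. fst (\<gamma> s)) has_real_derivative
            - snd (\<gamma> s) + l * (fst (\<gamma> s))\<^sup>2 + m * fst (\<gamma> s) * snd (\<gamma> s) + n * (snd (\<gamma> s))\<^sup>2) (at s)"
    and "((\<lambda>s. snd (\<gamma> s)) has_real_derivative fst (\<gamma> s) * (1 - snd (\<gamma> s))) (at s)"
  using bounded_linear.has_vector_derivative[OF bounded_linear_fst assms]
    bounded_linear.has_vector_derivative[OF bounded_linear_snd assms]
  by (simp_all add: quad_field_def case_prod_beta has_real_derivative_iff_has_vector_derivative)

text \<open>The line \<open>y = 1\<close> is invariant.\<close>

lemma right_arc_below:
  assumes arc: "right_arc l m n a b \<gamma> s0 s1" and "a < 1 \<or> b < 1" and s: "s \<in> {s0..s1}"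
  shows "snd (\<gamma> s) < 1"
proof -
  define x q where "x = (\<lambda>s. fst (\<gamma> s))" and "q = (\<lambda>s. 1 - snd (\<gamma> s))"
  have ss: "s0 < s1" and cont: "continuous_on {s0..s1} x" "continuous_on {s0..s1} q"
    using arc by (auto simp: right_arc_def x_def q_def intro!: continuous_intros)
  obtain M where M: "\<And>u. u \<in> {s0..s1} \<Longrightarrow> \<bar>x u\<bar> \<le> M"
    using compact_imp_bounded[OF compact_continuous_image[OF cont(1) compact_Icc]]
    unfolding bounded_iff real_norm_def by blast
  have der: "(q has_real_derivative - x u * q u) (at u)" if "s0 < u" "u < s1" for u
  proof -
    have "(\<gamma> has_vector_derivative quad_field l m n (\<gamma> u)) (at u)"
      using arc that by (auto simp: right_arc_def right_orbit_on_def)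
    from quad_orbit_components(2)[OF this] show ?thesis
      unfolding q_def x_def by (auto intro!: derivative_eq_intros)
  qed
  \<comment> \<open>The equation \<open>q' = - x * q\<close> is linear with a bounded coefficient.
    The square is a nonnegative quantity to which the two-sided estimate applies; it carries
    \<open>q v \<noteq> 0\<close> from one end to all times.\<close>
  have gw: "(q u)\<^sup>2 \<le> exp (2 * M * \<bar>u - v\<bar>) * (q v)\<^sup>2" if "u \<in> {s0..s1}" "v \<in> {s0..s1}" for u v
  proof (rule gronwall_two_sided[of s0 s1 "\<lambda>u. (q u)\<^sup>2" "\<lambda>u. - 2 * x u * (q u)\<^sup>2"])
    fix w assume w: "s0 < w" "w < s1"
    show "((\<lambda>u. (q u)\<^sup>2) has_real_derivative - 2 * x w * (q w)\<^sup>2) (at w)"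
      by (auto intro!: derivative_eq_intros der w simp: power2_eq_square)
    show "\<bar>- 2 * x w * (q w)\<^sup>2\<bar> \<le> 2 * M * (q w)\<^sup>2"
      using M[of w] w by (auto simp: abs_mult intro!: mult_right_mono)
  qed (use that cont in \<open>auto intro!: continuous_intros\<close>)
  obtain v where v: "v \<in> {s0..s1}" "q v > 0"
  proof (cases "a < 1")
    case True
    then show ?thesis using that[of s0] arc by (auto simp: right_arc_def q_def)
  next
    case False
    then show ?thesis using that[of s1] arc assms(2) by (auto simp: right_arc_def q_def)
  qed
  have nz: "q u \<noteq> 0" if "u \<in> {s0..s1}" for u
    using gw[OF v(1) that] v by auto
  have "q s > 0"
  proof (rule ccontr)
    assume neg: "\<not> q s > 0"
    have "connected (q ` {s0..s1})" by (intro connected_continuous_image cont) simp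
    then have "0 \<in> q ` {s0..s1}"
      by (rule connectedD_interval[of _ "q s" "q v"]) (use neg v s in auto)
    then show False using nz by auto
  qed
  then show ?thesis by (simp add: q_def)
qed

text \<open>Since \<open>y < 1\<close> along the arc, \<open>y' = x * (1 - y)\<close> is positive
  inside and the height can replace the time: \<open>f\<close> is \<open>x\<close> composed with the
  inverse of \<open>y\<close>, whose continuity comes from compactness.\<close>

lemma right_arc_graph:
  assumes arc: "right_arc l m n a b \<gamma> s0 s1" and ab: "a < 1 \<or> b < 1"
  obtains f where "half_arc l m n a b f" "\<gamma> ` {s0..s1} = (\<lambda>y. (f y, y)) ` {a..b}"
proof -
  define x y where "x = (\<lambda>s. fst (\<gamma> s))" and "y = (\<lambda>s. snd (\<gamma> s))"
  have ss: "s0 < s1" and cont: "continuous_on {s0..s1} x" "continuous_on {s0..s1} y"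
    using arc by (auto simp: right_arc_def x_def y_def intro!: continuous_intros)
  have ends: "x s0 = 0" "x s1 = 0" "y s0 = a" "y s1 = b" using arc by (auto simp: right_arc_def x_def y_def)
  have xpos: "x s > 0" and
    derx: "(x has_real_derivative - y s + l * (x s)\<^sup>2 + m * x s * y s + n * (y s)\<^sup>2) (at s)" and
    dery: "(y has_real_derivative x s * (1 - y s)) (at s)" if "s0 < s" "s < s1" for s
  proof -
    have "(\<gamma> has_vector_derivative quad_field l m n (\<gamma> s)) (at s)" "fst (\<gamma> s) > 0"
      using arc that by (auto simp: right_arc_def right_orbit_on_def)
    then show "x s > 0" "(x has_real_derivative - y s + l * (x s)\<^sup>2 + m * x s * y s + n * (y s)\<^sup>2) (at s)"
      "(y has_real_derivative x s * (1 - y s)) (at s)"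
      using quad_orbit_components unfolding x_def y_def by blast+
  qed
  have below: "y s < 1" if "s \<in> {s0..s1}" for s
    using right_arc_below[OF arc ab that] by (simp add: y_def)
  have mono: "y u < y v" if "s0 \<le> u" "u < v" "v \<le> s1" for u v
  proof (rule DERIV_pos_imp_increasing_open[OF \<open>u < v\<close>])
    fix s assume s: "u < s" "s < v"
    then have "x s * (1 - y s) > 0" using xpos[of s] below[of s] that by auto
    then show "\<exists>d. (y has_real_derivative d) (at s) \<and> 0 < d" using dery[of s] s that by auto
  qed (use continuous_on_subset[OF cont(2)] that in auto)
  have inj: "inj_on y {s0..s1}"
    by (rule linorder_inj_onI) (use mono in \<open>force+\<close>)
  have img: "y ` {s0..s1} = {a..b}"
  proof
    show "y ` {s0..s1} \<subseteq> {a..b}"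
    proof
      fix v assume "v \<in> y ` {s0..s1}"
      then obtain s where s: "s \<in> {s0..s1}" "v = y s" by blast
      have "a \<le> y s" using mono[of s0 s] s ends by (cases "s = s0") auto
      moreover have "y s \<le> b" using mono[of s s1] s ends by (cases "s = s1") auto
      ultimately show "v \<in> {a..b}" using s by simp
    qed
    have "connected (y ` {s0..s1})" by (intro connected_continuous_image cont) simp
    moreover have "a \<in> y ` {s0..s1}" "b \<in> y ` {s0..s1}" using ends ss by force+
    ultimately show "{a..b} \<subseteq> y ` {s0..s1}" using connected_contains_Icc by blast
  qed
  define \<tau> where "\<tau> = inv_into {s0..s1} y"
  have \<tau>cont: "continuous_on {a..b} \<tau>"
    unfolding \<tau>_def img[symmetric] 
    by (intro continuous_on_inv[OF cont(2) compact_Icc] ballI inv_into_f_f inj)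
  have \<tau>: "\<tau> v \<in> {s0..s1}" "y (\<tau> v) = v" if "v \<in> {a..b}" for v
    using that inv_into_into[of v y "{s0..s1}"] f_inv_into_f[of v y "{s0..s1}"] by (auto simp: \<tau>_def img)
  have \<tau>y: "\<tau> (y s) = s" if "s \<in> {s0..s1}" for s using that inj by (simp add: \<tau>_def)
  define f where "f = (\<lambda>v. x (\<tau> v))"
  have "a < b" using mono[of s0 s1] ss ends by simp
  have "half_arc l m n a b f" unfolding half_arc_def
  proof (intro conjI ballI)
    show "continuous_on {a..b} f" unfolding f_def
      by (rule continuous_on_compose2[OF cont(1) \<tau>cont]) (use \<tau> in blast)
    show "f a = 0" "f b = 0" using \<tau>y[of s0] \<tau>y[of s1] ends ss by (auto simp: f_def)
    fix v assume v: "v \<in> {a<..<b}"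
    then have tv: "s0 < \<tau> v" "\<tau> v < s1" using \<tau>[of v] ends by (auto simp: less_le)
    have isC: "isCont \<tau> v" using \<tau>cont v
      by (metis (no_types, lifting) at_within_Icc_at atLeastAtMost_iff continuous_on_eq_continuous_within
          greaterThanLessThan_iff less_imp_le)
    have yv: "y (\<tau> v) = v" using \<tau> v by simp
    show fv: "f v > 0" using xpos tv by (simp add: f_def)
    have "v < 1" using below[of "\<tau> v"] tv yv by simp
    have "(\<tau> has_real_derivative inverse (x (\<tau> v) * (1 - y (\<tau> v)))) (at v)"
      by (rule DERIV_inverse_function[where f = y and a = a and b = b])
         (use dery[OF tv] v isC fv \<open>v < 1\<close> yv \<tau> in \<open>auto simp: f_def\<close>)
    from DERIV_chain2[OF derx[OF tv] this]
    show "(f has_real_derivative (- v + l * (f v)\<^sup>2 + m * f v * v + n * v\<^sup>2) / (f v * (1 - v))) (at v)"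
      unfolding f_def yv divide_inverse .
  qed (use \<open>a < b\<close> in auto)
  moreover have "\<gamma> ` {s0..s1} = (\<lambda>y. (f y, y)) ` {a..b}"
  proof -
    have "\<gamma> s = (f (y s), y s)" if "s \<in> {s0..s1}" for s
      using \<tau>y[OF that] by (simp add: f_def x_def y_def)
    then have "\<gamma> ` {s0..s1} = (\<lambda>v. (f v, v)) ` (y ` {s0..s1})" by (auto simp: image_image)
    then show ?thesis by (simp add: img)
  qed
  ultimately show ?thesis using that by blast
qed

section \<open>Existence of arcs through points near the origin\<close>

text \<open>With \<open>u = x + i y\<close> the system reads
  \<open>u' = i u + quad_part l m n u\<close>, the linear part being multiplication by
  \<open>\<i>\<close>.\<close>

definition quad_part :: "real \<Rightarrow> real \<Rightarrow> real \<Rightarrow> complex \<Rightarrow> complex" where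
  "quad_part l m n u = complex_of_real (l * (Re u)\<^sup>2 + m * Re u * Im u + n * (Im u)\<^sup>2) - \<i> * complex_of_real (Re u * Im u)"

text \<open>The Lipschitz constant is proportional to the size of \<open>u\<close> and
  \<open>v\<close>; therefore Picard iteration over a fixed time span succeeds for points close
  enough to the origin.\<close>

lemma quad_part_Lipschitz:
  "cmod (quad_part l m n u - quad_part l m n v)
     \<le> (\<bar>l\<bar> + \<bar>m\<bar> + \<bar>n\<bar> + 1) * (cmod u + cmod v) * cmod (u - v)"
proof -
  have prod: "\<bar>p * q - p' * q'\<bar> \<le> (cmod u + cmod v) * cmod (u - v)"
    if "\<bar>p - p'\<bar> \<le> cmod (u - v)" "\<bar>q - q'\<bar> \<le> cmod (u - v)" "\<bar>p\<bar> \<le> cmod u" "\<bar>q'\<bar> \<le> cmod v" for p q p' q'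
  proof -
    have "p * q - p' * q' = p * (q - q') + (p - p') * q'" by (simp add: algebra_simps)
    also have "\<bar>\<dots>\<bar> \<le> \<bar>p\<bar> * \<bar>q - q'\<bar> + \<bar>p - p'\<bar> * \<bar>q'\<bar>"
      by (metis abs_mult abs_triangle_ineq)
    also have "\<dots> \<le> cmod u * cmod (u - v) + cmod (u - v) * cmod v"
      using that by (intro add_mono mult_mono) auto
    finally show ?thesis by (simp add: algebra_simps)
  qed
  have comp: "\<bar>Re u - Re v\<bar> \<le> cmod (u - v)" "\<bar>Im u - Im v\<bar> \<le> cmod (u - v)"
    using abs_Re_le_cmod[of "u - v"] abs_Im_le_cmod[of "u - v"] by auto
  define E where "E = (cmod u + cmod v) * cmod (u - v)"
  have a: "\<bar>(Re u)\<^sup>2 - (Re v)\<^sup>2\<bar> \<le> E" "\<bar>Re u * Im u - Re v * Im v\<bar> \<le> E" "\<bar>(Im u)\<^sup>2 - (Im v)\<^sup>2\<bar> \<le> E"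
    unfolding power2_eq_square E_def by (intro prod comp abs_Re_le_cmod abs_Im_le_cmod)+
  have re: "Re (quad_part l m n u - quad_part l m n v)
      = l * ((Re u)\<^sup>2 - (Re v)\<^sup>2) + m * (Re u * Im u - Re v * Im v) + n * ((Im u)\<^sup>2 - (Im v)\<^sup>2)"
    by (simp add: quad_part_def algebra_simps)
  have "\<bar>Re (quad_part l m n u - quad_part l m n v)\<bar> \<le> \<bar>l\<bar> * E + \<bar>m\<bar> * E + \<bar>n\<bar> * E"
    unfolding re
    by (intro order_trans[OF abs_triangle_ineq] add_mono; (simp only: abs_mult)?; intro mult_left_mono a) auto
  moreover have "\<bar>Im (quad_part l m n u - quad_part l m n v)\<bar> \<le> E"
    using a(2) by (simp add: quad_part_def abs_minus_commute)
  ultimately have "cmod (quad_part l m n u - quad_part l m n v) \<le> \<bar>l\<bar> * E + \<bar>m\<bar> * E + \<bar>n\<bar> * E + E"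
    using cmod_le[of "quad_part l m n u - quad_part l m n v"] by linarith
  also have "\<dots> = (\<bar>l\<bar> + \<bar>m\<bar> + \<bar>n\<bar> + 1) * E" by (simp add: algebra_simps)
  finally show ?thesis by (simp only: E_def mult.assoc)
qed

lemma first_zero:
  fixes f :: "real \<Rightarrow> real"
  assumes cont: "continuous_on {t..T} f" and "t < T" "f t > 0" "f T < 0"
  obtains s where "t < s" "s < T" "f s = 0" "\<And>u. t \<le> u \<Longrightarrow> u < s \<Longrightarrow> f u > 0"
proof -
  define Z where "Z = {t..T} \<inter> f -` {..0}"
  have "closed Z" unfolding Z_def by (intro continuous_closed_preimage cont) auto
  moreover have "T \<in> Z" using assms by (auto simp: Z_def)
  moreover have bdd: "bdd_below Z" by (auto simp: Z_def intro!: bdd_belowI[of _ t])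
  ultimately have "Inf Z \<in> Z" using closed_contains_Inf by blast
  define s where "s = Inf Z"
  have s: "t \<le> s" "s \<le> T" "f s \<le> 0" using \<open>Inf Z \<in> Z\<close> by (auto simp: s_def Z_def)
  have pos: "f u > 0" if "t \<le> u" "u < s" for u
  proof (rule ccontr)
    assume "\<not> f u > 0"
    then have "u \<in> Z" using that s by (auto simp: Z_def)
    then show False using cInf_lower[OF _ bdd] that by (fastforce simp: s_def)
  qed
  have "t < s" using s assms by (cases "t = s") auto
  have "f s = 0"
  proof (rule ccontr)
    assume "f s \<noteq> 0"
    then have "f s < 0" using s by simp
    then obtain u where "t \<le> u" "u \<le> s" "f u = 0"
      using IVT2'[of f s 0 t] assms \<open>t < s\<close> s continuous_on_subset[OF cont, of "{t..s}"] by auto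
    then show False using pos[of u] \<open>f s < 0\<close> by (cases "u = s") auto
  qed
  moreover have "s < T" using s assms \<open>f s = 0\<close> by (cases "s = T") auto
  ultimately show ?thesis using that \<open>t < s\<close> pos by blast
qed

lemma cis_has_vector_derivative: "(cis has_vector_derivative \<i> * cis t) (at t)"
  using has_derivative_cis[OF has_derivative_ident, of t UNIV] by (simp add: has_vector_derivative_def)

text \<open>In the rotating frame only the quadratic part remains, so Picard iteration near \<open>p\<close>
  reaches more than a full turn and the solution stays close to the rotation of \<open>p\<close>.\<close>

lemma quad_orbit_near_rotation:
  fixes l m n :: real and p :: complex
  assumes "288 * (\<bar>l\<bar> + \<bar>m\<bar> + \<bar>n\<bar> + 1) * cmod p \<le> 1" "p \<noteq> 0"
  obtains g where "g 0 = p" "\<And>t. cmod (g t - cis t * p) \<le> cmod p / 4"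
    "\<And>t. \<bar>t\<bar> < 6 \<Longrightarrow> (g has_vector_derivative \<i> * g t + quad_part l m n (g t)) (at t)"
proof -
  define C where "C = \<bar>l\<bar> + \<bar>m\<bar> + \<bar>n\<bar> + 1"
  define G where "G = (\<lambda>t u. cis (- t) * quad_part l m n (cis t * u))"
  have "C > 0" "cmod p > 0" using assms by (auto simp: C_def intro: add_nonneg_pos)
  have Cp: "288 * C * cmod p \<le> 1" using assms by (simp add: C_def)
  have near: "cmod u \<le> 2 * cmod p" if "cmod (u - p) \<le> cmod p / 4" for u
    using that norm_triangle_sub[of u p] \<open>cmod p > 0\<close> by linarith
  have Glip: "cmod (G t u - G t v) \<le> C * (cmod u + cmod v) * cmod (u - v)" for t u v
  proof -
    have "cmod (G t u - G t v) = cmod (quad_part l m n (cis t * u) - quad_part l m n (cis t * v))"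
      by (simp add: G_def norm_mult flip: right_diff_distrib)
    also have "\<dots> \<le> C * (cmod (cis t * u) + cmod (cis t * v)) * cmod (cis t * u - cis t * v)"
      unfolding C_def by (rule quad_part_Lipschitz)
    also have "\<dots> = C * (cmod u + cmod v) * cmod (u - v)"
      by (simp add: norm_mult flip: right_diff_distrib)
    finally show ?thesis .
  qed
  have G0: "G t 0 = 0" for t by (simp add: G_def quad_part_def)
  have cont: "continuous_on UNIV (\<lambda>(t, u). G t u)"
    unfolding G_def quad_part_def case_prod_beta by (intro continuous_intros)
  obtain \<zeta> where \<zeta>: "\<zeta> 0 = p" "\<And>t. cmod (\<zeta> t - p) \<le> cmod p / 4"
    "\<And>t. t \<in> {-6<..<6} \<Longrightarrow> (\<zeta> has_vector_derivative G t (\<zeta> t)) (at t)"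
  \<comment> \<open>Time 6 exceeds \<open>3 * pi / 2\<close>, the longest rotation used later. With
    these arguments \<open>3 * \<tau> * B \<le> R\<close> becomes
    \<open>72 * C * (cmod p)\<^sup>2 \<le> cmod p / 4\<close>, whence the constant 288; the
    contraction factor \<open>72 * C * cmod p\<close> is then at most 1/4.\<close>
  proof (rule picard_lindeloef_ball[OF cont, of 6 "cmod p / 4" "4 * C * cmod p" p "4 * C * (cmod p)\<^sup>2"])
    fix t u assume u: "cmod (u - p) \<le> cmod p / 4"
    have "cmod (G t u) \<le> C * cmod u * cmod u" using Glip[of t u 0] by (simp add: G0)
    also have "\<dots> \<le> C * (2 * cmod p) * (2 * cmod p)"
      using near[OF u] \<open>C > 0\<close> by (intro mult_mono) auto
    finally show "cmod (G t u) \<le> 4 * C * (cmod p)\<^sup>2" by (simp add: power2_eq_square)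
  next
    fix t u v assume u: "cmod (u - p) \<le> cmod p / 4" and v: "cmod (v - p) \<le> cmod p / 4"
    have "C * (cmod u + cmod v) * cmod (u - v) \<le> C * (2 * cmod p + 2 * cmod p) * cmod (u - v)"
      using near[OF u] near[OF v] \<open>C > 0\<close> by (intro mult_right_mono mult_left_mono add_mono) auto
    then show "cmod (G t u - G t v) \<le> 4 * C * cmod p * cmod (u - v)"
      using Glip[of t u v] by simp
  next
    have "288 * C * cmod p * cmod p \<le> 1 * cmod p" using Cp by (rule mult_right_mono) simp
    then show "3 * 6 * (4 * C * (cmod p)\<^sup>2) \<le> cmod p / 4" by (simp add: power2_eq_square)
  qed (use Cp \<open>C > 0\<close> in auto)
  show ?thesis
  proof
    show "cis 0 * \<zeta> 0 = p" using \<zeta> by simp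
    have "cis t * \<zeta> t - cis t * p = cis t * (\<zeta> t - p)" for t by (simp add: right_diff_distrib)
    then show "cmod (cis t * \<zeta> t - cis t * p) \<le> cmod p / 4" for t
      using \<zeta>(2)[of t] by (simp add: norm_mult)
    fix t :: real assume "\<bar>t\<bar> < 6"
    then have "(\<zeta> has_vector_derivative G t (\<zeta> t)) (at t)" by (intro \<zeta>) auto
    from has_vector_derivative_mult[OF cis_has_vector_derivative this]
    have "((\<lambda>t. cis t * \<zeta> t) has_vector_derivative cis t * G t (\<zeta> t) + \<i> * cis t * \<zeta> t) (at t)" .
    moreover have "cis t * G t (\<zeta> t) = quad_part l m n (cis t * \<zeta> t)"
      by (simp add: G_def cis_mult flip: mult.assoc)
    ultimately show "((\<lambda>t. cis t * \<zeta> t) has_vector_derivative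
        \<i> * (cis t * \<zeta> t) + quad_part l m n (cis t * \<zeta> t)) (at t)"
      by (simp add: add.commute mult.assoc)
  qed
qed

text \<open>The orbit through \<open>p\<close> follows a rotation so closely that \<open>x\<close>
  becomes negative both forwards and backwards in time; the arc runs between the two zeros of
  \<open>x\<close> around the starting time. On the axis \<open>x' = - y * (1 - n * y)\<close> has
  the sign of \<open>- y\<close>, which determines the upper and the lower end.\<close>

lemma right_arc_through:
  fixes p :: "real \<times> real"
  assumes small: "288 * (\<bar>l\<bar> + \<bar>m\<bar> + \<bar>n\<bar> + 1) * norm p \<le> 1" and "p \<noteq> 0" "fst p \<ge> 0"
  obtains a b \<gamma> s0 s1 where "right_arc l m n a b \<gamma> s0 s1" "p \<in> \<gamma> ` {s0..s1}"
    "a < 0" "0 < b" "- (2 * norm p) < a" "b < 2 * norm p"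
proof -
  define r where "r = norm p"
  define P where "P = Complex (fst p) (snd p)"
  have r: "cmod P = r" "r > 0"
    using \<open>p \<noteq> 0\<close> by (simp_all add: P_def r_def complex_norm norm_prod_def flip: zero_less_norm_iff)
  obtain g where g: "g 0 = P" "\<And>t. cmod (g t - cis t * P) \<le> r / 4"
    "\<And>t. \<bar>t\<bar> < 6 \<Longrightarrow> (g has_vector_derivative \<i> * g t + quad_part l m n (g t)) (at t)"
  proof (rule quad_orbit_near_rotation[of l m n P])
    show "288 * (\<bar>l\<bar> + \<bar>m\<bar> + \<bar>n\<bar> + 1) * cmod P \<le> 1" using small r by (simp add: r_def)
    show "P \<noteq> 0" using r by auto
  qed (use r in auto)
  define x y \<gamma> where "x = (\<lambda>t. Re (g t))" and "y = (\<lambda>t. Im (g t))" and "\<gamma> = (\<lambda>t. (Re (g t), Im (g t)))"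
  have derx: "(x has_real_derivative - y t + l * (x t)\<^sup>2 + m * x t * y t + n * (y t)\<^sup>2) (at t)"
    and der\<gamma>: "(\<gamma> has_vector_derivative quad_field l m n (\<gamma> t)) (at t)" if "\<bar>t\<bar> < 6" for t
  proof -
    have re: "((\<lambda>t. Re (g t)) has_vector_derivative Re (\<i> * g t + quad_part l m n (g t))) (at t)"
      and im: "((\<lambda>t. Im (g t)) has_vector_derivative Im (\<i> * g t + quad_part l m n (g t))) (at t)"
      using g(3)[OF that] by (auto simp: has_vector_derivative_complex_iff has_real_derivative_iff_has_vector_derivative)
    show "(x has_real_derivative - y t + l * (x t)\<^sup>2 + m * x t * y t + n * (y t)\<^sup>2) (at t)"
      using re by (simp add: x_def y_def quad_part_def has_real_derivative_iff_has_vector_derivative algebra_simps)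
    show "(\<gamma> has_vector_derivative quad_field l m n (\<gamma> t)) (at t)"
      using has_vector_derivative_Pair[OF re im]
      by (simp add: \<gamma>_def quad_field_def quad_part_def algebra_simps)
  qed
  have contx: "continuous_on {t..t'} x" and cont\<gamma>: "continuous_on {t..t'} \<gamma>" if "-6 < t" "t' < 6" for t t'
    using that
    by (auto intro!: continuous_at_imp_continuous_on DERIV_isCont[OF derx]
        has_vector_derivative_continuous[OF der\<gamma>])
  define \<theta> where "\<theta> = Arg P"
  have P: "P = of_real r * cis \<theta>" using rcis_cmod_Arg[of P] r by (simp add: \<theta>_def rcis_def)
  have \<theta>: "\<bar>\<theta>\<bar> \<le> pi / 2" using assms(3) Arg_Re_nonneg[of P] by (simp add: P_def \<theta>_def)
  have nearx: "\<bar>x t - r * cos (t + \<theta>)\<bar> \<le> r / 4" for t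
  proof -
    have "Re (g t - cis t * P) = x t - r * cos (t + \<theta>)"
      by (simp add: x_def P cos_add algebra_simps)
    then show ?thesis using abs_Re_le_cmod[of "g t - cis t * P"] g(2)[of t] by simp
  qed
  have norms: "3 / 4 * r \<le> cmod (g t)" "cmod (g t) \<le> 5 / 4 * r" for t
  proof -
    have "cmod (cis t * P) = r" using r by (simp add: norm_mult)
    then show "3 / 4 * r \<le> cmod (g t)" "cmod (g t) \<le> 5 / 4 * r"
      using g(2)[of t] norm_triangle_sub[of "g t" "cis t * P"] norm_triangle_sub[of "cis t * P" "g t"]
        norm_minus_commute[of "g t" "cis t * P"] by linarith+
  qed
  \<comment> \<open>At these times the rotated point lies on the negative x-axis, so
    \<open>x\<close> is at most \<open>- 3/4 * r\<close>. As
    \<open>\<bar>\<theta>\<bar> \<le> pi / 2\<close>, both lie within the time span of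
    \<open>g\<close>.\<close>
  define Tp Tm where "Tp = pi - \<theta>" and "Tm = - pi - \<theta>"
  have T: "1 < Tp" "Tp < 6" "-6 < Tm" "Tm < -1"
    using \<theta> pi_gt3 pi_less_4 by (auto simp: Tp_def Tm_def abs_le_iff)
  have xT: "x Tp < 0" "x Tm < 0" 
  proof -
    have "cos (Tp + \<theta>) = -1" "cos (Tm + \<theta>) = -1" by (simp_all add: Tp_def Tm_def)
    then show "x Tp < 0" "x Tm < 0"
      using abs_le_D1[OF nearx[of Tp]] abs_le_D1[OF nearx[of Tm]] r(2) by auto
  qed
  have n_small: "\<bar>n * y t\<bar> < 1" for t
  proof -
    have "\<bar>n * y t\<bar> \<le> (\<bar>l\<bar> + \<bar>m\<bar> + \<bar>n\<bar> + 1) * (5 / 4 * r)"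
      unfolding abs_mult using norms(2)[of t] abs_Im_le_cmod[of "g t"]
      by (intro mult_mono) (auto simp: y_def)
    also have "\<dots> < 288 * ((\<bar>l\<bar> + \<bar>m\<bar> + \<bar>n\<bar> + 1) * r)"
      using r by (simp add: add_nonneg_pos)
    also have "\<dots> \<le> 1" using small by (simp only: r_def mult.assoc)
    finally show ?thesis .
  qed
  \<comment> \<open>If \<open>p\<close> lies on the axis it is itself an end of the arc, and
    \<open>t0\<close> is a nearby time with \<open>x > 0\<close>: before 0 if
    \<open>y 0 > 0\<close>, after 0 if \<open>y 0 < 0\<close>. The last two clauses keep time 0
    between the zeros found from \<open>t0\<close>.\<close>
  have "\<exists>t0. \<bar>t0\<bar> \<le> 1 \<and> x t0 > 0 \<and> (\<forall>t. t0 \<le> t \<and> t < 0 \<longrightarrow> x t > 0) \<and> (\<forall>t. 0 < t \<and> t \<le> t0 \<longrightarrow> x t > 0)"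
  proof (cases "x 0 > 0")
    case True
    then show ?thesis by (intro exI[of _ 0]) auto
  next
    case False
    then have x0: "x 0 = 0" using assms(3) g(1) by (simp add: x_def P_def)
    have "y 0 \<noteq> 0" using norms(1)[of 0] r x0 by (auto simp: x_def y_def cmod_eq_Re)
    have d: "(x has_real_derivative - y 0 * (1 - n * y 0)) (at 0)"
      using derx[of 0] by (simp add: x0 algebra_simps power2_eq_square)
    have n0: "1 - n * y 0 > 0" using n_small[of 0] by (simp add: abs_less_iff)
    show ?thesis
    proof (cases "y 0 > 0")
      case True
      then have "- y 0 * (1 - n * y 0) < 0" using n0 by (simp add: mult_neg_pos)
      from DERIV_neg_dec_left[OF d this] obtain e where e: "e > 0" "\<forall>h>0. h < e \<longrightarrow> x 0 < x (0 - h)" by blast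
      have "x t > 0" if "- min 1 (e / 2) \<le> t" "t < 0" for t
        using e(2)[rule_format, of "- t"] that e(1) x0 by auto
      then show ?thesis using e(1) by (intro exI[of _ "- min 1 (e / 2)"]) auto
    next
      case False
      then have "- y 0 * (1 - n * y 0) > 0" using n0 \<open>y 0 \<noteq> 0\<close> by (simp add: mult_neg_pos)
      from DERIV_pos_inc_right[OF d this] obtain e where e: "e > 0" "\<forall>h>0. h < e \<longrightarrow> x 0 < x (0 + h)" by blast
      have "x t > 0" if "t \<le> min 1 (e / 2)" "0 < t" for t
        using e(2)[rule_format, of t] that e(1) x0 by auto
      then show ?thesis using e(1) by (intro exI[of _ "min 1 (e / 2)"]) auto
    qed
  qed
  then obtain t0 where t0: "\<bar>t0\<bar> \<le> 1" "x t0 > 0" "\<And>t. t0 \<le> t \<Longrightarrow> t < 0 \<Longrightarrow> x t > 0"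
    "\<And>t. 0 < t \<Longrightarrow> t \<le> t0 \<Longrightarrow> x t > 0" by blast
  have t0b: "-1 \<le> t0" "t0 \<le> 1" using t0(1) by auto
  obtain s1 where s1: "t0 < s1" "s1 < Tp" "x s1 = 0" "\<And>u. t0 \<le> u \<Longrightarrow> u < s1 \<Longrightarrow> x u > 0"
    using first_zero[of t0 Tp x] contx[of t0 Tp] t0(2) t0b T xT by auto
  \<comment> \<open>The last zero before \<open>t0\<close> is the first zero of the time-reversed
    function.\<close>
  have contm: "continuous_on {- t0..- Tm} (\<lambda>t. x (- t))"
    by (rule continuous_on_compose2[OF contx[of Tm t0]]) (use T t0b in \<open>auto intro!: continuous_intros\<close>)
  obtain s' where s': "- t0 < s'" "s' < - Tm" "x (- s') = 0" "\<And>u. - t0 \<le> u \<Longrightarrow> u < s' \<Longrightarrow> x (- u) > 0"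
    using first_zero[OF contm] t0(2) t0b T xT by auto
  define s0 where "s0 = - s'"
  have s0: "Tm < s0" "s0 < t0" "x s0 = 0" using s' by (auto simp: s0_def)
  have xpos: "x u > 0" if "s0 < u" "u < s1" for u
    using s1(4)[of u] s'(4)[of "- u"] that by (cases "t0 \<le> u") (auto simp: s0_def)
  have s_bounds: "-6 < s0" "s0 < 6" "-6 < s1" "s1 < 6" using s0 s1 T t0b by auto
  have y_end: "- y s * (1 - n * y s) \<noteq> 0 \<and> (x has_real_derivative - y s * (1 - n * y s)) (at s) \<and> 1 - n * y s > 0"
    if "x s = 0" "-6 < s" "s < 6" for s
  proof -
    have "y s \<noteq> 0" using norms(1)[of s] r that by (auto simp: x_def y_def cmod_eq_Re)
    moreover have "1 - n * y s > 0" using n_small[of s] by (simp add: abs_less_iff)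
    moreover have "(x has_real_derivative - y s * (1 - n * y s)) (at s)"
      using derx[of s] that by (simp add: algebra_simps power2_eq_square)
    ultimately show ?thesis by auto
  qed
  have "y s1 > 0"
  proof (rule ccontr)
    assume "\<not> y s1 > 0"
    then have "- y s1 * (1 - n * y s1) > 0"
      using y_end[of s1] s1 s_bounds by (metis less_le linorder_not_less mult_nonneg_nonneg neg_0_le_iff_le)
    with DERIV_pos_inc_left[of x _ s1] y_end[of s1] s1 s_bounds
    obtain e where e: "e > 0" "\<forall>h>0. h < e \<longrightarrow> x (s1 - h) < x s1" by blast
    define h where "h = min (e / 2) ((s1 - s0) / 2)"
    have "h > 0" "h < e" "s0 < s1 - h" using e s0 s1 by (auto simp: h_def min_def field_simps)
    then show False using e(2) xpos[of "s1 - h"] s1(3) by fastforce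
  qed
  have "y s0 < 0"
  proof (rule ccontr)
    assume "\<not> y s0 < 0"
    then have "- y s0 * (1 - n * y s0) < 0"
      using y_end[of s0] s0 s_bounds by (simp add: mult_less_0_iff)
    with DERIV_neg_dec_right[of x _ s0] y_end[of s0] s0 s_bounds
    obtain e where e: "e > 0" "\<forall>h>0. h < e \<longrightarrow> x (s0 + h) < x s0" by blast
    define h where "h = min (e / 2) ((s1 - s0) / 2)"
    have "h > 0" "h < e" "s0 + h < s1" using e s0 s1 by (auto simp: h_def min_def field_simps)
    then show False using e(2) xpos[of "s0 + h"] s0(3) by fastforce
  qed
  have y_bound: "\<bar>y t\<bar> < 2 * r" for t
    using norms(2)[of t] abs_Im_le_cmod[of "g t"] r by (simp add: y_def)
  have zero_in: "0 \<in> {s0..s1}"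
  proof (rule ccontr)
    assume "0 \<notin> {s0..s1}"
    then have "s1 < 0 \<or> 0 < s0" by auto
    then show False using t0(3)[of s1] t0(4)[of s0] s0 s1 by auto
  qed
  show ?thesis
  proof
    show "right_arc l m n (y s0) (y s1) \<gamma> s0 s1"
      unfolding right_arc_def right_orbit_on_def
      using s0 s1 s_bounds cont\<gamma>[of s0 s1] der\<gamma> xpos by (auto simp: \<gamma>_def x_def y_def)
    have "\<gamma> 0 = p" by (simp add: \<gamma>_def g P_def)
    then show "p \<in> \<gamma> ` {s0..s1}" using zero_in by force
    show "y s0 < 0" "0 < y s1" by fact+
    show "- (2 * norm p) < y s0" "y s1 < 2 * norm p"
      using y_bound[of s0] y_bound[of s1] by (auto simp: r_def abs_less_iff)
  qed
qed

section \<open>Crossing periodic orbits\<close>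

abbreviation mirror :: "real \<times> real \<Rightarrow> real \<times> real" where
  "mirror p \<equiv> (- fst p, snd p)"

text \<open>The shift \<open>c\<close> lets a reflected arc begin at the time when another one
  ends.\<close>

lemma mirror_orbit:
  assumes "(\<gamma> has_vector_derivative quad_field l m n (\<gamma> (c - t))) (at (c - t))"
  shows "((\<lambda>t. mirror (\<gamma> (c - t))) has_vector_derivative quad_field l (- m) n (mirror (\<gamma> (c - t)))) (at t)"
proof -
  have "((\<lambda>t. c - t) has_vector_derivative -1) (at t)"
    by (auto intro!: derivative_eq_intros)
  from vector_diff_chain_at[OF this assms]
  have "((\<lambda>t. \<gamma> (c - t)) has_vector_derivative - quad_field l m n (\<gamma> (c - t))) (at t)"
    by (simp add: o_def)
  from has_vector_derivative_Pair[OF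
      has_vector_derivative_minus[OF bounded_linear.has_vector_derivative[OF bounded_linear_fst this]]
      bounded_linear.has_vector_derivative[OF bounded_linear_snd this]]
  show ?thesis by (simp add: quad_field_def case_prod_beta algebra_simps)
qed

text \<open>The region \<open>R\<close> between the graphs is open and bounded, contains the origin,
  and has its frontier on the curve. The connected component of the origin in the complement cannot
  meet this frontier, so it stays in \<open>R\<close>.\<close>

lemma zero_in_inside_graphs:
  fixes a b :: real and f g :: "real \<Rightarrow> real"
  assumes ab: "a < 0" "0 < b"
    and cont: "continuous_on {a..b} f" "continuous_on {a..b} g"
    and ends: "f a = 0" "f b = 0" "g a = 0" "g b = 0"
    and pos: "f 0 > 0" "g 0 > 0"
  shows "(0, 0) \<in> inside ((\<lambda>y. (f y, y)) ` {a..b} \<union> (\<lambda>y. (- g y, y)) ` {a..b})"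
    (is "_ \<in> inside ?\<Gamma>")
proof -
  \<comment> \<open>Clamping the height makes \<open>F\<close> and \<open>G\<close> continuous on
    the whole plane. As \<open>f\<close> and \<open>g\<close> vanish at \<open>a\<close> and
    \<open>b\<close>, both are 0 at heights outside \<open>{a..b}\<close>, where the strict
    inequalities defining \<open>R\<close> then fail.\<close>
  define c where "c = (\<lambda>p :: real \<times> real. max a (min b (snd p)))"
  define F G where "F = (\<lambda>p. f (c p))" and "G = (\<lambda>p. - g (c p))"
  have c: "c p \<in> {a..b}" for p using ab by (auto simp: c_def)
  have "continuous_on UNIV c" unfolding c_def by (intro continuous_intros)
  then have contFG: "continuous_on UNIV F" "continuous_on UNIV G" unfolding F_def G_def
    using c by (auto intro!: continuous_on_minus continuous_on_compose2[OF cont(1)] continuous_on_compose2[OF cont(2)])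
  define R where "R = {p. G p < fst p} \<inter> {p. fst p < F p}"
  define K where "K = {p. G p \<le> fst p} \<inter> {p. fst p \<le> F p} \<inter> {p. a \<le> snd p} \<inter> {p. snd p \<le> b}"
  have "open R" unfolding R_def by (intro open_Int open_Collect_less contFG continuous_intros)
  have "closed K" unfolding K_def by (intro closed_Int closed_Collect_le contFG continuous_intros)
  have "R \<subseteq> K"
  proof
    fix p assume p: "p \<in> R"
    have "a \<le> snd p" "snd p \<le> b"
      using p ends by (auto simp: R_def F_def G_def c_def max_def min_def split: if_splits)
    then show "p \<in> K" using p by (auto simp: R_def K_def)
  qed
  have "K - R \<subseteq> ?\<Gamma>"
  proof
    fix p assume p: "p \<in> K - R"
    then have y: "snd p \<in> {a..b}" "c p = snd p" by (auto simp: K_def c_def)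
    have "fst p = f (snd p) \<or> fst p = - g (snd p)"
      using p y by (auto simp: K_def R_def F_def G_def)
    then show "p \<in> ?\<Gamma>" using y by (cases p) auto
  qed
  moreover have "frontier R \<subseteq> K - R"
    using closure_minimal[OF \<open>R \<subseteq> K\<close> \<open>closed K\<close>] interior_open[OF \<open>open R\<close>] by (auto simp: frontier_def)
  ultimately have front: "frontier R \<subseteq> ?\<Gamma>" by blast
  have "bounded (f ` {a..b})" "bounded (g ` {a..b})"
    using cont by (auto intro!: compact_imp_bounded compact_continuous_image)
  then obtain M N where MN: "\<And>y. y \<in> {a..b} \<Longrightarrow> \<bar>f y\<bar> \<le> M" "\<And>y. y \<in> {a..b} \<Longrightarrow> \<bar>g y\<bar> \<le> N"
    unfolding bounded_iff real_norm_def by blast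
  have "K \<subseteq> {- N..M} \<times> {a..b}"
  proof
    fix p assume p: "p \<in> K"
    have "\<bar>f (c p)\<bar> \<le> M" "\<bar>g (c p)\<bar> \<le> N" using MN c by auto
    then show "p \<in> {- N..M} \<times> {a..b}" using p by (cases p) (auto simp: K_def F_def G_def)
  qed
  moreover have "bounded ({- N..M} \<times> {a..b})" by (intro bounded_Times bounded_closed_interval)
  ultimately have "bounded R" using \<open>R \<subseteq> K\<close> bounded_subset by blast
  have c0: "c (0, 0) = 0" using ab by (simp add: c_def)
  have zero: "(0, 0) \<in> R" using pos c0 by (simp add: R_def F_def G_def)
  have not_on: "(0, 0) \<notin> ?\<Gamma>" using pos by auto
  have self: "(0, 0) \<in> connected_component_set (- ?\<Gamma>) (0, 0)"
    using not_on by (simp add: connected_component_refl)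
  have "connected_component_set (- ?\<Gamma>) (0, 0) \<subseteq> R"
  proof (rule ccontr)
    assume "\<not> connected_component_set (- ?\<Gamma>) (0, 0) \<subseteq> R"
    then have "connected_component_set (- ?\<Gamma>) (0, 0) \<inter> frontier R \<noteq> {}"
      using self zero by (intro connected_Int_frontier connected_connected_component) blast+
    then show False using front connected_component_subset[of "- ?\<Gamma>" "(0, 0)"] by blast
  qed
  then show ?thesis using \<open>bounded R\<close> not_on by (auto simp: inside_def intro: bounded_subset)
qed

lemma right_arcs_glue:
  assumes arc1: "right_arc l1 m1 n a b \<gamma>1 s0 s1" and arc2: "right_arc l2 (- m2) n a b \<gamma>2 u0 u1"
    and ab: "a < 0" "0 < b" "n * a < 1" "n * b < 1"
  defines "\<Gamma> \<equiv> \<gamma>1 ` {s0..s1} \<union> (\<lambda>p. mirror p) ` \<gamma>2 ` {u0..u1}"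
  shows "crossing_periodic_orbit (quad_field l1 m1 n) (quad_field l2 m2 n) \<Gamma>" "(0, 0) \<in> inside \<Gamma>"
proof -
  \<comment> \<open>\<open>c - s1 = u1\<close> and \<open>c - s2 = u0\<close>: the second arc is
    traversed backwards, from its upper to its lower end.\<close>
  define c where "c = u1 + s1"
  define s2 where "s2 = s1 + (u1 - u0)"
  define \<gamma> where "\<gamma> = (\<lambda>t. if t \<le> s1 then \<gamma>1 t else mirror (\<gamma>2 (c - t)))"
  define t where "t = (\<lambda>i::nat. if i = 0 then s0 else if i = 1 then s1 else s2)"
  have a1: "s0 < s1" "continuous_on {s0..s1} \<gamma>1" "\<gamma>1 s0 = (0, a)" "\<gamma>1 s1 = (0, b)"
    "right_orbit_on (quad_field l1 m1 n) \<gamma>1 {s0<..<s1}"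
    and a2: "u0 < u1" "continuous_on {u0..u1} \<gamma>2" "\<gamma>2 u0 = (0, a)" "\<gamma>2 u1 = (0, b)"
    "right_orbit_on (quad_field l2 (- m2) n) \<gamma>2 {u0<..<u1}"
    using arc1 arc2 by (auto simp: right_arc_def)
  have "s1 < s2" using a2 by (simp add: s2_def)
  have cont2: "continuous_on {s1..s2} (\<lambda>t. mirror (\<gamma>2 (c - t)))"
  proof -
    have "continuous_on {s1..s2} (\<lambda>t. \<gamma>2 (c - t))"
      by (rule continuous_on_compose2[OF a2(2)]) (auto simp: c_def s2_def intro!: continuous_intros)
    then show ?thesis by (intro continuous_intros)
  qed
  have "continuous_on ({s0..s1} \<union> {s1..s2}) \<gamma>" unfolding \<gamma>_def
    by (rule continuous_on_cases[OF _ _ a1(2) cont2]) (auto simp: c_def a1 a2)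
  moreover have Un: "{s0..s1} \<union> {s1..s2} = {s0..s2}" using a1(1) \<open>s1 < s2\<close> by auto
  ultimately have cont: "continuous_on {s0..s2} \<gamma>" by simp
  \<comment> \<open>On \<open>x = 0\<close> both fields have the first component
    \<open>- q * (1 - n * q)\<close>, so the product is a square and only its vanishing has to be
    excluded.\<close>
  have cross: "crossing_point (quad_field l1 m1 n) (quad_field l2 m2 n) (0, q)" if "q \<noteq> 0" "n * q < 1" for q
  proof -
    have "- q + n * q\<^sup>2 = - q * (1 - n * q)" by (simp add: power2_eq_square algebra_simps)
    then have "- q + n * q\<^sup>2 \<noteq> 0" using that by simp
    then have "(- q + n * q\<^sup>2) * (- q + n * q\<^sup>2) > 0" using not_real_square_gt_zero by blast
    then show ?thesis by (simp add: crossing_point_def quad_field_def)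
  qed
  have vals: "\<gamma> s0 = (0, a)" "\<gamma> s1 = (0, b)" "\<gamma> s2 = (0, a)"
    using a1 a2 \<open>s1 < s2\<close> by (auto simp: \<gamma>_def c_def s2_def)
  have right: "right_orbit_on (quad_field l1 m1 n) \<gamma> {s0<..<s1}"
    unfolding right_orbit_on_def
  proof (intro ballI conjI)
    fix s assume s: "s \<in> {s0<..<s1}"
    then have *: "fst (\<gamma>1 s) > 0" "(\<gamma>1 has_vector_derivative quad_field l1 m1 n (\<gamma>1 s)) (at s)" "\<gamma> s = \<gamma>1 s"
      using a1 by (auto simp: right_orbit_on_def \<gamma>_def)
    then show "fst (\<gamma> s) > 0" by simp
    show "(\<gamma> has_vector_derivative quad_field l1 m1 n (\<gamma> s)) (at s)" unfolding *(3)
      by (rule has_vector_derivative_transform_within_open[OF *(2) open_greaterThanLessThan s])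
         (simp add: \<gamma>_def)
  qed
  have left: "left_orbit_on (quad_field l2 m2 n) \<gamma> {s1<..<s2}"
    unfolding left_orbit_on_def
  proof (intro ballI conjI)
    fix s assume s: "s \<in> {s1<..<s2}"
    then have "c - s \<in> {u0<..<u1}" by (auto simp: c_def s2_def)
    then have *: "fst (\<gamma>2 (c - s)) > 0"
      "(\<gamma>2 has_vector_derivative quad_field l2 (- m2) n (\<gamma>2 (c - s))) (at (c - s))"
      and eq: "\<gamma> s = mirror (\<gamma>2 (c - s))"
      using a2 s by (auto simp: right_orbit_on_def \<gamma>_def)
    then show "fst (\<gamma> s) < 0" by simp
    have "((\<lambda>t. mirror (\<gamma>2 (c - t))) has_vector_derivative quad_field l2 m2 n (\<gamma> s)) (at s)"
      using mirror_orbit[OF *(2)] eq by simp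
    then show "(\<gamma> has_vector_derivative quad_field l2 m2 n (\<gamma> s)) (at s)"
      by (rule has_vector_derivative_transform_within_open[OF _ open_greaterThanLessThan s])
         (simp add: \<gamma>_def)
  qed
  have img: "\<gamma> ` {s0..s2} = \<Gamma>"
  proof -
    have "\<gamma> ` {s0..s2} = \<gamma> ` {s0..s1} \<union> \<gamma> ` {s1..s2}"
      unfolding Un[symmetric] by (rule image_Un)
    also have "\<gamma> ` {s0..s1} = \<gamma>1 ` {s0..s1}" by (auto simp: \<gamma>_def)
    also have "\<gamma> ` {s1..s2} = (\<lambda>t. mirror (\<gamma>2 (c - t))) ` {s1..s2}"
    proof (rule image_cong[OF refl])
      fix x assume "x \<in> {s1..s2}"
      then show "\<gamma> x = mirror (\<gamma>2 (c - x))" using a1 a2 by (cases "x = s1") (auto simp: \<gamma>_def c_def)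
    qed
    also have "\<dots> = (\<lambda>p. mirror p) ` \<gamma>2 ` ((\<lambda>t. c - t) ` {s1..s2})" by (simp only: image_image)
    also have "(\<lambda>t. c - t) ` {s1..s2} = {u0..u1}" by (simp add: c_def s2_def)
    finally show ?thesis by (simp add: \<Gamma>_def)
  qed
  show "crossing_periodic_orbit (quad_field l1 m1 n) (quad_field l2 m2 n) \<Gamma>"
    unfolding crossing_periodic_orbit_def
  proof (intro exI[of _ \<gamma>] exI[of _ "2::nat"] exI[of _ t] conjI allI impI)
    fix i :: nat
    show "t i < t (Suc i)" if "i < 2" using that a1 \<open>s1 < s2\<close> by (auto simp: t_def less_2_cases_iff)
    show "crossing_point (quad_field l1 m1 n) (quad_field l2 m2 n) (\<gamma> (t i))" if "i \<le> 2"
      using ab by (auto simp: t_def vals intro!: cross)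
    show "right_orbit_on (quad_field l1 m1 n) \<gamma> {t i<..<t (Suc i)} \<or>
          left_orbit_on (quad_field l2 m2 n) \<gamma> {t i<..<t (Suc i)}" if "i < 2"
      using that left right by (auto simp: t_def less_2_cases_iff)
  qed (use cont img vals in \<open>auto simp: t_def\<close>)
  obtain f where f: "half_arc l1 m1 n a b f" "\<gamma>1 ` {s0..s1} = (\<lambda>y. (f y, y)) ` {a..b}"
    using right_arc_graph[OF arc1] ab by auto
  obtain g where g: "half_arc l2 (- m2) n a b g" "\<gamma>2 ` {u0..u1} = (\<lambda>y. (g y, y)) ` {a..b}"
    using right_arc_graph[OF arc2] ab by auto
  have "\<Gamma> = (\<lambda>y. (f y, y)) ` {a..b} \<union> (\<lambda>y. (- g y, y)) ` {a..b}"
    unfolding \<Gamma>_def f(2) g(2) by (simp add: image_image)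
  then show "(0, 0) \<in> inside \<Gamma>"
    using zero_in_inside_graphs[OF ab(1,2), of f g] f(1) g(1) ab by (auto simp: half_arc_def)
qed

section \<open>Sufficiency: matching the arcs of the two sides\<close>

text \<open>If \<open>l + n = 0\<close>, an arc of the system with \<open>m'\<close> is constructed
  through the lower end \<open>(0, a)\<close>. Its upper end and \<open>b\<close> satisfy the same
  relation with \<open>a\<close>, and \<open>Psi\<close> is strictly increasing at positive heights,
  so they coincide.\<close>

lemma right_arc_transfer:
  assumes "m = m' \<or> l + n = 0"
  obtains \<epsilon> where "\<epsilon> > 0"
    "\<And>a b \<gamma> s0 s1. right_arc l m n a b \<gamma> s0 s1 \<Longrightarrow> - \<epsilon> < a \<Longrightarrow> a < 0 \<Longrightarrow> 0 < b \<Longrightarrow> b < \<epsilon> \<Longrightarrow>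
       \<exists>\<gamma>' u0 u1. right_arc l m' n a b \<gamma>' u0 u1"
proof (cases "m = m'")
  case True
  then show ?thesis using that[of 1] by auto
next
  case False
  then have l: "l = - n" using assms by simp
  obtain e1 where e1: "e1 > 0"
    "\<And>a b f. half_arc (- n) m n a b f \<Longrightarrow> - e1 < a \<Longrightarrow> a < e1 \<Longrightarrow> b < e1 \<Longrightarrow> Psi (1 + n) n a = Psi (1 + n) n b"
    using half_arc_first_integral[of n m] by blast
  obtain e2 where e2: "e2 > 0"
    "\<And>a b f. half_arc (- n) m' n a b f \<Longrightarrow> - e2 < a \<Longrightarrow> a < e2 \<Longrightarrow> b < e2 \<Longrightarrow> Psi (1 + n) n a = Psi (1 + n) n b"
    using half_arc_first_integral[of n m'] by blast
  define A where "A = 288 * (\<bar>l\<bar> + \<bar>m'\<bar> + \<bar>n\<bar> + 1)"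
  have "A > 0" by (simp add: A_def add_nonneg_pos)
  \<comment> \<open>The halved bounds leave room for the new upper end, which is only known to lie
    below \<open>2 * \<bar>a\<bar>\<close>.\<close>
  define \<epsilon> where "\<epsilon> = min (min (1 / A) (rad (1 + n) n / 2)) (min (min e1 e2 / 2) (1/2))"
  show ?thesis
  proof
    show "\<epsilon> > 0" using e1 e2 rad_pos \<open>A > 0\<close> by (auto simp: \<epsilon>_def)
    fix a b \<gamma> s0 s1
    assume arc: "right_arc l m n a b \<gamma> s0 s1" and ab: "- \<epsilon> < a" "a < 0" "0 < b" "b < \<epsilon>"
    have bnd: "- (1 / A) < a" "2 * \<bar>a\<bar> < rad (1 + n) n" "b < rad (1 + n) n" "2 * \<bar>a\<bar> < e1" "2 * \<bar>a\<bar> < e2" "b < e1"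
      "2 * \<bar>a\<bar> < 1" "b < 1"
      using ab rad_pos[of "1 + n" n] e1(1) by (auto simp: \<epsilon>_def min_def split: if_splits)
    have norm_le: "A * norm (0::real, a) \<le> 1" using bnd(1) ab \<open>A > 0\<close> by (simp add: norm_prod_def field_simps)
    obtain a' b' \<gamma>' u0 u1 where arc': "right_arc l m' n a' b' \<gamma>' u0 u1" "(0, a) \<in> \<gamma>' ` {u0..u1}"
      "a' < 0" "0 < b'" "b' < 2 * norm (0::real, a)"
    proof (rule right_arc_through[of l m' n "(0, a)"])
      show "288 * (\<bar>l\<bar> + \<bar>m'\<bar> + \<bar>n\<bar> + 1) * norm (0::real, a) \<le> 1"
        using norm_le by (simp only: A_def)
      show "(0, a) \<noteq> (0 :: real \<times> real)" using ab by (simp add: zero_prod_def)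
    qed (use that in auto)
    obtain s where s: "s \<in> {u0..u1}" "\<gamma>' s = (0, a)" using arc'(2) by force
    \<comment> \<open>Interior points of the arc have \<open>x > 0\<close>, so \<open>(0, a)\<close>
      is one of its ends, and because of \<open>a < 0 < b'\<close> it is the lower one.\<close>
    have "\<not> (u0 < s \<and> s < u1)" using s(2) arc'(1)
      by (force simp: right_arc_def right_orbit_on_def)
    then have "s = u0 \<or> s = u1" using s by auto
    moreover have "\<gamma>' u0 = (0, a')" "\<gamma>' u1 = (0, b')" using arc'(1) by (auto simp: right_arc_def)
    ultimately have "a' = a" using s(2) \<open>0 < b'\<close> ab by auto
    have "b' < 2 * \<bar>a\<bar>" using arc'(5) by (simp add: norm_prod_def)
    obtain f where "half_arc l m n a b f"
      by (rule right_arc_graph[OF arc]) (use bnd(8) in auto)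
    then have "half_arc (- n) m n a b f" by (simp add: l)
    then have "Psi (1 + n) n a = Psi (1 + n) n b" using e1(2) bnd ab by auto
    moreover obtain f' where "half_arc l m' n a b' f'"
      by (rule right_arc_graph[OF arc'(1)]) (use ab \<open>a' = a\<close> in auto)
    then have "half_arc (- n) m' n a b' f'" by (simp add: l)
    then have "Psi (1 + n) n a = Psi (1 + n) n b'" using e2(2) bnd ab \<open>b' < 2 * \<bar>a\<bar>\<close> by auto
    ultimately have "b = b'"
      using Psi_strict_mono[of b b' "1 + n" n] Psi_strict_mono[of b' b "1 + n" n] ab arc'(4) bnd \<open>b' < 2 * \<bar>a\<bar>\<close>
      by (cases b b' rule: linorder_cases) auto
    then show "\<exists>\<gamma>' u0 u1. right_arc l m' n a b \<gamma>' u0 u1" using arc'(1) \<open>a' = a\<close> by blast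
  qed
qed

text \<open>A point near the origin lies on an arc of its own side, after reflection if
  \<open>x < 0\<close>; the transfer supplies an arc with the same ends on the other side, and
  gluing closes the orbit. The transfer is used in both directions because the point may lie on
  either side.\<close>

lemma center_sufficient:
  assumes "m1 = - m2 \<or> l + n = 0"
  shows "origin_is_center (quad_field l m1 n) (quad_field l m2 n)"
proof -
  let ?X = "quad_field l m1 n" and ?Y = "quad_field l m2 n"
  obtain e1 where e1: "e1 > 0"
    "\<And>a b \<gamma> s0 s1. right_arc l m1 n a b \<gamma> s0 s1 \<Longrightarrow> - e1 < a \<Longrightarrow> a < 0 \<Longrightarrow> 0 < b \<Longrightarrow> b < e1 \<Longrightarrow>
       \<exists>\<gamma>' u0 u1. right_arc l (- m2) n a b \<gamma>' u0 u1"
    using right_arc_transfer[OF assms] by blast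
  have "- m2 = m1 \<or> l + n = 0" using assms by auto
  then obtain e2 where e2: "e2 > 0"
    "\<And>a b \<gamma> s0 s1. right_arc l (- m2) n a b \<gamma> s0 s1 \<Longrightarrow> - e2 < a \<Longrightarrow> a < 0 \<Longrightarrow> 0 < b \<Longrightarrow> b < e2 \<Longrightarrow>
       \<exists>\<gamma>' u0 u1. right_arc l m1 n a b \<gamma>' u0 u1"
    using right_arc_transfer by blast
  define A where "A = 288 * (\<bar>l\<bar> + \<bar>m1\<bar> + \<bar>m2\<bar> + \<bar>n\<bar> + 1)"
  have "A > 0" by (simp add: A_def add_nonneg_pos)
  define \<epsilon> where "\<epsilon> = min (min (1 / A) (1 / (2 * (1 + \<bar>n\<bar>)) / 2)) (min e1 e2 / 2)"
  have "\<epsilon> > 0" using e1(1) e2(1) \<open>A > 0\<close> by (simp add: \<epsilon>_def add_pos_nonneg)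
  define \<C> where "\<C> = {\<Gamma>. crossing_periodic_orbit ?X ?Y \<Gamma> \<and> (0, 0) \<in> inside \<Gamma>}"
  have cover: "p \<in> \<Union>\<C>" if p: "p \<noteq> (0, 0)" "norm p < \<epsilon>" for p
  proof -
    have np: "A * norm p \<le> 1" "2 * norm p < 1 / (2 * (1 + \<bar>n\<bar>))" "2 * norm p < e1" "2 * norm p < e2"
      using p(2) \<open>A > 0\<close> by (auto simp: \<epsilon>_def field_simps)
    have le: "288 * (\<bar>l\<bar> + \<bar>m\<bar> + \<bar>n\<bar> + 1) * norm p \<le> 1" if "\<bar>m\<bar> \<le> \<bar>m1\<bar> + \<bar>m2\<bar>" for m
      by (rule order_trans[OF mult_right_mono np(1)]) (use that in \<open>auto simp: A_def\<close>)
    show ?thesis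
    proof (cases "fst p \<ge> 0")
      case True
      obtain a b \<gamma> s0 s1 where arc: "right_arc l m1 n a b \<gamma> s0 s1" "p \<in> \<gamma> ` {s0..s1}"
        "a < 0" "0 < b" "- (2 * norm p) < a" "b < 2 * norm p"
        by (rule right_arc_through[of l m1 n p]) (use le[of m1] p True in \<open>auto simp: zero_prod_def\<close>)
      have "n * a < 1" "n * b < 1"
        using small_denominator(1)[of a n] small_denominator(1)[of b n] arc np by auto
      moreover obtain \<gamma>' u0 u1 where "right_arc l (- m2) n a b \<gamma>' u0 u1"
        using e1(2)[OF arc(1)] arc np by auto
      ultimately have "\<gamma> ` {s0..s1} \<union> (\<lambda>p. mirror p) ` \<gamma>' ` {u0..u1} \<in> \<C>"
        using right_arcs_glue[OF arc(1)] arc(3,4) by (auto simp: \<C>_def)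
      then show ?thesis using arc(2) by blast
    next
      case False
      have nm: "norm (mirror p) = norm p" by (simp add: norm_prod_def)
      obtain a b \<gamma> s0 s1 where arc: "right_arc l (- m2) n a b \<gamma> s0 s1" "mirror p \<in> \<gamma> ` {s0..s1}"
        "a < 0" "0 < b" "- (2 * norm p) < a" "b < 2 * norm p"
      proof (rule right_arc_through[of l "- m2" n "mirror p"])
        show "288 * (\<bar>l\<bar> + \<bar>- m2\<bar> + \<bar>n\<bar> + 1) * norm (mirror p) \<le> 1" unfolding nm by (rule le) simp
        show "mirror p \<noteq> 0" "fst (mirror p) \<ge> 0" using False by (auto simp: zero_prod_def)
      qed (use that in \<open>simp only: nm\<close>)
      have "n * a < 1" "n * b < 1"
        using small_denominator(1)[of a n] small_denominator(1)[of b n] arc np by auto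
      moreover obtain \<gamma>' u0 u1 where "right_arc l m1 n a b \<gamma>' u0 u1"
        using e2(2)[OF arc(1)] arc np by auto
      ultimately have "\<gamma>' ` {u0..u1} \<union> (\<lambda>p. mirror p) ` \<gamma> ` {s0..s1} \<in> \<C>"
        using right_arcs_glue[OF _ arc(1)] arc(3,4) by (auto simp: \<C>_def)
      moreover have "p \<in> (\<lambda>p. mirror p) ` \<gamma> ` {s0..s1}"
        by (rule image_eqI[OF _ arc(2)]) simp
      ultimately show ?thesis by blast
    qed
  qed
  show ?thesis unfolding origin_is_center_def
  \<comment> \<open>The neighborhood is the union of the orbits itself, so that orbits may leave the
    ball of radius \<open>\<epsilon>\<close>.\<close>
  proof (intro exI[of _ "insert (0, 0) (\<Union>\<C>)"] exI[of _ \<C>] conjI)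
    have "ball (0, 0) \<epsilon> \<subseteq> insert (0, 0) (\<Union>\<C>)"
    proof
      fix p :: "real \<times> real" assume "p \<in> ball (0, 0) \<epsilon>"
      then have "norm p < \<epsilon>" by (simp flip: zero_prod_def)
      then show "p \<in> insert (0, 0) (\<Union>\<C>)" using cover by blast
    qed
    then show "(0, 0) \<in> interior (insert (0, 0) (\<Union>\<C>))"
      using \<open>\<epsilon> > 0\<close> by (meson centre_in_ball interiorI open_ball)
    show "\<forall>\<Gamma>\<in>\<C>. crossing_periodic_orbit ?X ?Y \<Gamma> \<and> (0, 0) \<in> inside \<Gamma>" by (simp add: \<C>_def)
    have "(0, 0) \<notin> \<Gamma>" if "\<Gamma> \<in> \<C>" for \<Gamma> using that by (auto simp: \<C>_def inside_def)
    then show "insert (0, 0) (\<Union>\<C>) - {(0, 0)} = \<Union>\<C>" by blast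
  qed
qed

section \<open>Necessity: excluding crossing periodic orbits near the origin\<close>

text \<open>The equation holds only at interior times, so the sign at the start is obtained as a
  limit: if \<open>h s0\<close> were negative, \<open>x\<close> would decrease from 0.\<close>

lemma start_derivative_nonneg:
  fixes x h :: "real \<Rightarrow> real"
  assumes "s0 < s1" "continuous_on {s0..s1} x" "continuous_on {s0..s1} h" "x s0 = 0"
    and pos: "\<And>s. s0 < s \<Longrightarrow> s < s1 \<Longrightarrow> x s > 0"
    and der: "\<And>s. s0 < s \<Longrightarrow> s < s1 \<Longrightarrow> (x has_real_derivative h s) (at s)"
  shows "h s0 \<ge> 0"
proof (rule ccontr)
  assume "\<not> h s0 \<ge> 0"
  then have "(h \<longlongrightarrow> h s0) (at s0 within {s0..s1})" "h s0 < 0"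
    using assms(1,3) by (auto simp: continuous_on_def)
  then have "\<forall>\<^sub>F s in at s0 within {s0..s1}. h s < 0" by (rule order_tendstoD(2))
  then obtain d where d: "d > 0" "\<And>s. s \<in> {s0..s1} \<Longrightarrow> s \<noteq> s0 \<Longrightarrow> dist s s0 < d \<Longrightarrow> h s < 0"
    by (auto simp: eventually_at)
  define u where "u = s0 + min (d / 2) ((s1 - s0) / 2)"
  have u: "s0 < u" "u < s1" "u < s0 + d" using d(1) assms(1) by (auto simp: u_def min_def field_simps)
  have "- x s0 < - x u"
  proof (rule DERIV_pos_imp_increasing_open[OF u(1)])
    fix s assume s: "s0 < s" "s < u"
    then have "h s < 0" using d(2)[of s] u by (auto simp: dist_real_def)
    then show "\<exists>y. ((\<lambda>s. - x s) has_real_derivative y) (at s) \<and> 0 < y"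
      using DERIV_minus[OF der[of s]] s u by (intro exI[of _ "- h s"]) auto
  next
    have "continuous_on {s0..u} x" by (rule continuous_on_subset[OF assms(2)]) (use u in auto)
    then show "continuous_on {s0..u} (\<lambda>s. - x s)" by (rule continuous_on_minus)
  qed
  then show False using pos[of u] u assms(4) by simp
qed

text \<open>On the axis the first component of the field decides whether a right arc may start or
  end at a given height. The upper end is reduced to the lower one by reversing time.\<close>

lemma right_arc_end_signs:
  assumes "right_arc l m n a b \<gamma> s0 s1"
  shows "- a + n * a\<^sup>2 \<ge> 0" "- b + n * b\<^sup>2 \<le> 0"
proof -
  define x h where "x = (\<lambda>s. fst (\<gamma> s))"
    and "h = (\<lambda>s. - snd (\<gamma> s) + l * (fst (\<gamma> s))\<^sup>2 + m * fst (\<gamma> s) * snd (\<gamma> s) + n * (snd (\<gamma> s))\<^sup>2)"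
  have arc: "s0 < s1" "continuous_on {s0..s1} \<gamma>" "\<gamma> s0 = (0, a)" "\<gamma> s1 = (0, b)"
    and orb: "\<And>s. s0 < s \<Longrightarrow> s < s1 \<Longrightarrow> x s > 0 \<and> (x has_real_derivative h s) (at s)"
    using assms quad_orbit_components(1) by (auto simp: right_arc_def right_orbit_on_def x_def h_def)
  have cont: "continuous_on {s0..s1} x" "continuous_on {s0..s1} h"
    unfolding x_def h_def using arc(2) by (auto intro!: continuous_intros)
  have "h s0 \<ge> 0"
    by (rule start_derivative_nonneg[OF arc(1) cont]) (use orb arc in \<open>auto simp: x_def\<close>)
  then show "- a + n * a\<^sup>2 \<ge> 0" by (simp add: h_def arc)
  have reflect: "continuous_on {- s1..- s0} (\<lambda>s. f (- s))" if "continuous_on {s0..s1} f" for f :: "real \<Rightarrow> real"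
    by (rule continuous_on_compose2[OF that]) (auto intro!: continuous_intros)
  have "- h (- (- s1)) \<ge> 0"
  proof (rule start_derivative_nonneg[of "- s1" "- s0" "\<lambda>s. x (- s)" "\<lambda>s. - h (- s)"])
    fix s assume s: "- s1 < s" "s < - s0"
    then have o: "x (- s) > 0" "(x has_real_derivative h (- s)) (at (- s))" using orb[of "- s"] by auto
    then show "x (- s) > 0" by simp
    show "((\<lambda>s. x (- s)) has_real_derivative - h (- s)) (at s)"
      using o(2) by (simp add: DERIV_mirror)
  qed (use reflect[OF cont(1)] reflect[OF cont(2)] arc in \<open>auto simp: x_def intro: continuous_on_minus\<close>)
  then show "- b + n * b\<^sup>2 \<le> 0" by (simp add: h_def arc)
qed

text \<open>Among the finitely many crossing points \<open>(0, q)\<close> of an orbit take the one with the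
  largest \<open>q < 0\<close>. If the orbit spirals inwards, the crossing two arcs later is larger still.\<close>

lemma no_inward_cycle:
  assumes "l2 > l1 \<or> l2 = l1 \<and> (l2 + n) * (m2 - m1) > 0"
  obtains \<epsilon> where "\<epsilon> > 0"
    "\<And>S y. finite S \<Longrightarrow> (\<And>q. q \<in> S \<Longrightarrow> - q + n * q\<^sup>2 \<noteq> 0) \<Longrightarrow>
      (\<And>q. q \<in> S \<Longrightarrow> \<exists>q'\<in>S. (\<exists>\<gamma> s0 s1. right_arc l1 m1 n q q' \<gamma> s0 s1) \<or> (\<exists>\<gamma> s0 s1. right_arc l2 m2 n q' q \<gamma> s0 s1)) \<Longrightarrow>
      y \<in> S \<Longrightarrow> - \<epsilon> < y \<Longrightarrow> y < 0 \<Longrightarrow> False"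
proof -
  obtain e1 where e1: "e1 > 0"
    "\<And>a1 a2 b f1 f2. half_arc l2 m2 n a1 b f1 \<Longrightarrow> half_arc l1 m1 n a2 b f2 \<Longrightarrow>
       a1 \<le> a2 \<Longrightarrow> - e1 < a2 \<Longrightarrow> a2 < 0 \<Longrightarrow> 0 < b \<Longrightarrow> b < e1 \<Longrightarrow> False"
    using half_arcs_no_common_end[OF assms] by blast
  define \<rho> where "\<rho> = min e1 (1 / (2 * (1 + \<bar>n\<bar>)))"
  have \<rho>: "\<rho> > 0" "\<rho> \<le> e1" "\<rho> \<le> 1 / (2 * (1 + \<bar>n\<bar>))" using e1 by (auto simp: \<rho>_def add_pos_nonneg)
  have "1 / (2 * (1 + \<bar>n\<bar>)) \<le> 1/2" by (simp add: divide_simps)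
  then have "\<rho> \<le> 1/2" using \<rho>(3) by (rule order_trans[rotated])
  obtain e2 where e2: "0 < e2" "e2 \<le> 1/2"
    "\<And>a b f y1 y2. half_arc l1 m1 n a b f \<Longrightarrow> y1 \<in> {a..b} \<Longrightarrow> y2 \<in> {a..b} \<Longrightarrow> f y2 = 0 \<Longrightarrow>
       \<bar>y1\<bar> \<le> 1/2 \<Longrightarrow> \<bar>y2\<bar> < e2 \<Longrightarrow> \<bar>f y1\<bar> < \<rho> \<and> \<bar>y1\<bar> < \<rho>"
    using half_arc_small[OF \<rho>(1), of l1 m1 n] by blast
  have sgn_pos: "- q + n * q\<^sup>2 > 0" if "\<bar>q\<bar> < \<rho>" "q < 0" for q
  proof -
    have "1 - n * q > 0" using small_denominator(1)[of q n] that \<rho> by auto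
    then have "- q * (1 - n * q) > 0" using that by (simp add: mult_neg_pos)
    then show ?thesis by (simp add: power2_eq_square algebra_simps)
  qed
  have sgn_neg: "- q + n * q\<^sup>2 \<le> 0" if "\<bar>q\<bar> < \<rho>" "q \<ge> 0" for q
  proof -
    have "1 - n * q > 0" using small_denominator(1)[of q n] that \<rho> by auto
    then have "q * (1 - n * q) \<ge> 0" using that by simp
    then show ?thesis by (simp add: power2_eq_square algebra_simps)
  qed
  define \<epsilon> where "\<epsilon> = min e2 \<rho>"
  show ?thesis
  proof
    show "\<epsilon> > 0" using e2 \<rho> by (simp add: \<epsilon>_def)
    fix S y
    assume S: "finite S" "\<And>q. q \<in> S \<Longrightarrow> - q + n * q\<^sup>2 \<noteq> 0"
      and succ: "\<And>q. q \<in> S \<Longrightarrow> \<exists>q'\<in>S. (\<exists>\<gamma> s0 s1. right_arc l1 m1 n q q' \<gamma> s0 s1) \<or> (\<exists>\<gamma> s0 s1. right_arc l2 m2 n q' q \<gamma> s0 s1)"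
      and y: "y \<in> S" "- \<epsilon> < y" "y < 0"
    define a where "a = Max {q \<in> S. q < 0}"
    have "a \<in> {q \<in> S. q < 0}" unfolding a_def by (rule Max_in) (use S y in auto)
    moreover have maximal: "q \<le> a" if "q \<in> S" "q < 0" for q
      unfolding a_def by (rule Max_ge) (use S that in auto)
    ultimately have a: "a \<in> S" "a < 0" "\<bar>a\<bar> < e2" "\<bar>a\<bar> < \<rho>"
      using maximal[OF y(1,3)] y(2) by (simp_all add: \<epsilon>_def abs_if)
    obtain b where b: "b \<in> S" "(\<exists>\<gamma> s0 s1. right_arc l1 m1 n a b \<gamma> s0 s1) \<or> (\<exists>\<gamma> s0 s1. right_arc l2 m2 n b a \<gamma> s0 s1)"
      using succ[OF a(1)] by blast
    \<comment> \<open>At \<open>a\<close> the field points into \<open>x > 0\<close>, so the link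
      from \<open>a\<close> cannot be an arc of the second system that ends there.\<close>
    then obtain \<gamma> s0 s1 where arc1: "right_arc l1 m1 n a b \<gamma> s0 s1"
      using right_arc_end_signs(2)[of l2 m2 n b a] sgn_pos[OF a(4,2)] by force
    obtain f where f: "half_arc l1 m1 n a b f" by (rule right_arc_graph[OF arc1]) (use a in auto)
    have ab: "a < b" "f a = 0" using f by (auto simp: half_arc_def)
    \<comment> \<open>The smallness estimate reaches only up to height 1/2. Applied to the truncated
      height it gives \<open>\<bar>w\<bar> < \<rho> \<le> 1/2\<close>, so nothing was cut off and
      \<open>w = b\<close>.\<close>
    define w where "w = min b (1/2)"
    have w: "a \<le> w" "w \<le> b" "w \<le> 1/2" using ab a by (auto simp: w_def)
    have "\<bar>w\<bar> \<le> 1/2" using w a(4) \<open>\<rho> \<le> 1/2\<close> by linarith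
    then have "\<bar>w\<bar> < \<rho>" using e2(3)[OF f, of w a] ab w a(3) by simp
    then have bs: "\<bar>b\<bar> < \<rho>" using \<open>\<rho> \<le> 1/2\<close> by (auto simp: w_def min_def split: if_splits)
    have b_neg: "- b + n * b\<^sup>2 < 0" using right_arc_end_signs(2)[OF arc1] S(2)[OF b(1)] by simp
    have "b > 0"
    proof (rule ccontr)
      assume "\<not> b > 0"
      then have "b < 0 \<or> b = 0" by auto
      then show False using b_neg sgn_pos[OF bs] by auto
    qed
    obtain a' where a': "a' \<in> S" "(\<exists>\<gamma> s0 s1. right_arc l1 m1 n b a' \<gamma> s0 s1) \<or> (\<exists>\<gamma> s0 s1. right_arc l2 m2 n a' b \<gamma> s0 s1)"
      using succ[OF b(1)] by blast
    then obtain \<gamma>' u0 u1 where arc2: "right_arc l2 m2 n a' b \<gamma>' u0 u1"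
      using right_arc_end_signs(1)[of l1 m1 n b a'] b_neg by force
    obtain g where g: "half_arc l2 m2 n a' b g"
      by (rule right_arc_graph[OF arc2]) (use bs \<open>\<rho> \<le> 1/2\<close> in auto)
    have "a' < b" using g by (simp add: half_arc_def)
    have "a' < 0"
    proof (rule ccontr)
      assume "\<not> a' < 0"
      then have "\<bar>a'\<bar> < \<rho>" "a' \<ge> 0" using \<open>a' < b\<close> bs by auto
      then show False using sgn_neg right_arc_end_signs(1)[OF arc2] S(2)[OF a'(1)] by force
    qed
    \<comment> \<open>Now two arcs share the upper end \<open>b\<close>, and the one of the second
      system starts no higher than \<open>a\<close>; this is the situation excluded by
      \<open>half_arcs_no_common_end\<close>.\<close>
    then have "a' \<le> a" using maximal a'(1) by simp
    then show False using e1(2)[OF g f] a bs \<open>b > 0\<close> \<rho> by auto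
  qed
qed

lemma partition_point:
  fixes t :: "nat \<Rightarrow> real"
  assumes "t 0 \<le> s" "s \<le> t k"
  shows "(\<exists>i\<le>k. s = t i) \<or> (\<exists>i<k. t i < s \<and> s < t (Suc i))"
  using assms
proof (induction k)
  case (Suc k)
  show ?case
  proof (cases "s \<le> t k")
    case True
    then show ?thesis using Suc.IH[OF Suc.prems(1)] by (meson less_SucI le_SucI)
  next
    case False
    then have "s = t (Suc k) \<or> t k < s \<and> s < t (Suc k)" using Suc.prems(2) by linarith
    then show ?thesis by blast
  qed
qed auto

text \<open>All that is retained of an orbit is the finite set of its crossing heights, each linked
  to a next and to a previous one; the backward links serve the orbits that spiral outwards. A left
  arc is recorded as a right arc of the reflected system with its ends exchanged.\<close>

lemma crossing_periodic_orbit_heights: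
  assumes orbit: "crossing_periodic_orbit (quad_field l1 m1 n) (quad_field l2 m2 n) \<Gamma>" and "(0, y) \<in> \<Gamma>"
  defines "link \<equiv> \<lambda>q q'. (\<exists>\<gamma> s0 s1. right_arc l1 m1 n q q' \<gamma> s0 s1) \<or>
      (\<exists>\<gamma> s0 s1. right_arc l2 (- m2) n q' q \<gamma> s0 s1)"
  obtains S where "finite S" "y \<in> S" "\<And>q. q \<in> S \<Longrightarrow> - q + n * q\<^sup>2 \<noteq> 0"
    "\<And>q. q \<in> S \<Longrightarrow> \<exists>q'\<in>S. link q q'" "\<And>q. q \<in> S \<Longrightarrow> \<exists>q'\<in>S. link q' q"
proof -
  obtain \<gamma> k t where k: "k > 0" and t: "\<And>i. i < k \<Longrightarrow> t i < t (Suc i)"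
    and cont: "continuous_on {t 0..t k} \<gamma>"
    and cross: "\<And>i. i \<le> k \<Longrightarrow> crossing_point (quad_field l1 m1 n) (quad_field l2 m2 n) (\<gamma> (t i))"
    and orb: "\<And>i. i < k \<Longrightarrow> right_orbit_on (quad_field l1 m1 n) \<gamma> {t i<..<t (Suc i)} \<or>
        left_orbit_on (quad_field l2 m2 n) \<gamma> {t i<..<t (Suc i)}"
    and closed: "\<gamma> (t k) = \<gamma> (t 0)" and \<Gamma>: "\<Gamma> = \<gamma> ` {t 0..t k}"
    using orbit unfolding crossing_periodic_orbit_def by blast
  define q where "q = (\<lambda>i. snd (\<gamma> (t i)))"
  have \<gamma>t: "\<gamma> (t i) = (0, q i)" if "i \<le> k" for i
    using cross[OF that] by (simp add: crossing_point_def q_def prod_eq_iff)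
  have mono: "t i \<le> t j" if "i \<le> j" "j \<le> k" for i j
    using that
  proof (induction j rule: dec_induct)
    case (step j)
    then show ?case using t[of j] by linarith
  qed simp
  have arcs: "link (q i) (q (Suc i))" if i: "i < k" for i
  proof -
    have sub: "continuous_on {t i..t (Suc i)} \<gamma>"
      by (rule continuous_on_subset[OF cont]) (use mono[of 0 i] mono[of "Suc i" k] i in auto)
    show ?thesis using orb[OF i]
    proof
      assume "right_orbit_on (quad_field l1 m1 n) \<gamma> {t i<..<t (Suc i)}"
      then have "right_arc l1 m1 n (q i) (q (Suc i)) \<gamma> (t i) (t (Suc i))"
        using t[OF i] sub \<gamma>t i by (simp add: right_arc_def)
      then show ?thesis unfolding link_def by blast
    next
      assume left: "left_orbit_on (quad_field l2 m2 n) \<gamma> {t i<..<t (Suc i)}"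
      have "right_arc l2 (- m2) n (q (Suc i)) (q i) (\<lambda>s. mirror (\<gamma> (0 - s))) (- t (Suc i)) (- t i)"
        unfolding right_arc_def
      proof (intro conjI)
        have "continuous_on {- t (Suc i)..- t i} (\<lambda>s. \<gamma> (0 - s))"
          by (rule continuous_on_compose2[OF sub]) (auto intro!: continuous_intros)
        then show "continuous_on {- t (Suc i)..- t i} (\<lambda>s. mirror (\<gamma> (0 - s)))"
          by (intro continuous_intros)
        show "right_orbit_on (quad_field l2 (- m2) n) (\<lambda>s. mirror (\<gamma> (0 - s))) {- t (Suc i)<..<- t i}"
          unfolding right_orbit_on_def
        proof (intro ballI conjI)
          fix s assume "s \<in> {- t (Suc i)<..<- t i}"
          then have "0 - s \<in> {t i<..<t (Suc i)}" by auto
          then have "fst (\<gamma> (0 - s)) < 0" "(\<gamma> has_vector_derivative quad_field l2 m2 n (\<gamma> (0 - s))) (at (0 - s))"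
            using left unfolding left_orbit_on_def by blast+
          then show "fst (mirror (\<gamma> (0 - s))) > 0"
            "((\<lambda>s. mirror (\<gamma> (0 - s))) has_vector_derivative
                quad_field l2 (- m2) n (mirror (\<gamma> (0 - s)))) (at s)"
            by (simp_all only: mirror_orbit) simp
        qed
      qed (use t[OF i] \<gamma>t i in auto)
      then show ?thesis unfolding link_def by blast
    qed
  qed
  show ?thesis
  proof
    show "finite (q ` {..k})" by simp
    obtain s where s: "s \<in> {t 0..t k}" "\<gamma> s = (0, y)" using assms(2) \<Gamma> by force
    \<comment> \<open>Open arcs avoid the axis, so a point of the orbit with \<open>x = 0\<close>
      belongs to a partition time.\<close>
    have "fst (\<gamma> s) \<noteq> 0" if "i < k" "t i < s" "s < t (Suc i)" for i
      using orb[OF that(1)] that by (force simp: right_orbit_on_def left_orbit_on_def)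
    then obtain i where "i \<le> k" "s = t i" using partition_point[of t s k] s by force
    then show "y \<in> q ` {..k}" using s(2) \<gamma>t[of i] by force
    fix r assume "r \<in> q ` {..k}"
    then obtain i where i: "i \<le> k" "r = q i" by auto
    have "(- q i + n * (q i)\<^sup>2) * (- q i + n * (q i)\<^sup>2) > 0"
      using cross[OF i(1)] \<gamma>t[OF i(1)] by (simp add: crossing_point_def quad_field_def)
    then show "- r + n * r\<^sup>2 \<noteq> 0" using i by auto
    \<comment> \<open>Closedness supplies the missing links: the height of index \<open>k\<close>
      continues with the arc of index 0, and the height of index 0 is preceded by the arc of index
      \<open>k - 1\<close>.\<close>
    have ends: "q k = q 0" by (simp add: q_def closed)
    show "\<exists>q'\<in>q ` {..k}. link r q'"
    proof (cases "i < k")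
      case True
      then show ?thesis using arcs[of i] i by auto
    next
      case False
      then show ?thesis using arcs[of 0] i k ends by (intro bexI[of _ "q (Suc 0)"]) auto
    qed
    show "\<exists>q'\<in>q ` {..k}. link q' r"
    proof (cases i)
      case (Suc j)
      then show ?thesis using arcs[of j] i by auto
    next
      case 0
      then show ?thesis using arcs[of "k - 1"] i k ends by (intro bexI[of _ "q (k - 1)"]) auto
    qed
  qed
qed

text \<open>A center has orbits through points \<open>(0, y)\<close> with \<open>y < 0\<close>
  arbitrarily close to the origin. If the conclusion fails, one of the two systems is strictly ahead
  of the other; in one case orbits would spiral inwards, and in the other case exchanging the
  systems and following the links backwards leads to the same contradiction.\<close>

lemma center_necessary:
  assumes center: "origin_is_center (quad_field l1 m1 n) (quad_field l2 m2 n)"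
  shows "l1 = l2 \<and> (m1 = - m2 \<or> l1 + n = 0)"
proof (rule ccontr)
  assume not: "\<not> ?thesis"
  obtain U \<C> where U: "(0, 0) \<in> interior U" "U - {(0, 0)} = \<Union>\<C>"
    and \<C>: "\<And>\<Gamma>. \<Gamma> \<in> \<C> \<Longrightarrow> crossing_periodic_orbit (quad_field l1 m1 n) (quad_field l2 m2 n) \<Gamma>"
    using center unfolding origin_is_center_def by blast
  obtain e where e: "e > 0" "ball (0, 0) e \<subseteq> U" using U(1) by (auto simp: mem_interior)
  have orbit: "\<exists>y \<Gamma>. - \<epsilon> < y \<and> y < 0 \<and> (0, y) \<in> \<Gamma> \<and>
      crossing_periodic_orbit (quad_field l1 m1 n) (quad_field l2 m2 n) \<Gamma>" if "\<epsilon> > 0" for \<epsilon>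
  proof -
    define y where "y = - min (e / 2) (\<epsilon> / 2)"
    have y: "- \<epsilon> < y" "y < 0" "- e < y" using e that by (auto simp: y_def)
    then have "(0, y) \<in> ball (0, 0) e" by (simp add: dist_prod_def)
    then have "(0, y) \<in> \<Union>\<C>" using e(2) U(2) y by (metis DiffI less_irrefl prod.inject singletonD subsetD)
    then show ?thesis using \<C> y by blast
  qed
  have "(l2 > l1 \<or> l2 = l1 \<and> (l2 + n) * (- m2 - m1) > 0) \<or> (l1 > l2 \<or> l1 = l2 \<and> (l1 + n) * (m1 - - m2) > 0)"
  proof (cases "l1 = l2")
    case True
    then have "(l1 + n) * (m1 + m2) \<noteq> 0" using not by auto
    then have "(l1 + n) * (m1 + m2) > 0 \<or> (l1 + n) * (- m2 - m1) > 0"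
      by (auto simp: algebra_simps neq_iff)
    then show ?thesis using True by auto
  qed auto
  then show False
  proof
    assume "l2 > l1 \<or> l2 = l1 \<and> (l2 + n) * (- m2 - m1) > 0"
    then obtain \<epsilon> where \<epsilon>: "\<epsilon> > 0" and no: "\<And>S y. finite S \<Longrightarrow> (\<And>q. q \<in> S \<Longrightarrow> - q + n * q\<^sup>2 \<noteq> 0) \<Longrightarrow>
      (\<And>q. q \<in> S \<Longrightarrow> \<exists>q'\<in>S. (\<exists>\<gamma> s0 s1. right_arc l1 m1 n q q' \<gamma> s0 s1) \<or> (\<exists>\<gamma> s0 s1. right_arc l2 (- m2) n q' q \<gamma> s0 s1)) \<Longrightarrow>
      y \<in> S \<Longrightarrow> - \<epsilon> < y \<Longrightarrow> y < 0 \<Longrightarrow> False"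
      by (rule no_inward_cycle) blast
    obtain y \<Gamma> where y: "- \<epsilon> < y" "y < 0" and \<Gamma>: "(0, y) \<in> \<Gamma>"
      "crossing_periodic_orbit (quad_field l1 m1 n) (quad_field l2 m2 n) \<Gamma>" using orbit[OF \<epsilon>] by blast
    from \<Gamma>(2,1) show False
      by (rule crossing_periodic_orbit_heights) (rule no[OF _ _ _ _ y])
  next
    assume "l1 > l2 \<or> l1 = l2 \<and> (l1 + n) * (m1 - - m2) > 0"
    then obtain \<epsilon> where \<epsilon>: "\<epsilon> > 0" and no: "\<And>S y. finite S \<Longrightarrow> (\<And>q. q \<in> S \<Longrightarrow> - q + n * q\<^sup>2 \<noteq> 0) \<Longrightarrow>
      (\<And>q. q \<in> S \<Longrightarrow> \<exists>q'\<in>S. (\<exists>\<gamma> s0 s1. right_arc l2 (- m2) n q q' \<gamma> s0 s1) \<or> (\<exists>\<gamma> s0 s1. right_arc l1 m1 n q' q \<gamma> s0 s1)) \<Longrightarrow>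
      y \<in> S \<Longrightarrow> - \<epsilon> < y \<Longrightarrow> y < 0 \<Longrightarrow> False"
      by (rule no_inward_cycle) blast
    obtain y \<Gamma> where y: "- \<epsilon> < y" "y < 0" and \<Gamma>: "(0, y) \<in> \<Gamma>"
      "crossing_periodic_orbit (quad_field l1 m1 n) (quad_field l2 m2 n) \<Gamma>" using orbit[OF \<epsilon>] by blast
    from \<Gamma>(2,1) show False
    proof (rule crossing_periodic_orbit_heights)
      fix S
      assume S: "finite S" "y \<in> S" "\<And>q. q \<in> S \<Longrightarrow> - q + n * q\<^sup>2 \<noteq> 0"
        and pred: "\<And>q. q \<in> S \<Longrightarrow> \<exists>q'\<in>S. (\<exists>\<gamma> s0 s1. right_arc l1 m1 n q' q \<gamma> s0 s1) \<or>
            (\<exists>\<gamma> s0 s1. right_arc l2 (- m2) n q q' \<gamma> s0 s1)"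
      show False by (rule no[OF S(1,3) _ S(2) y]) (use pred in \<open>auto simp: disj_commute\<close>)
    qed
  qed
qed

theorem corollary1p7:
  fixes l1 l2 m1 m2 n :: real
  shows "origin_is_center (quad_field l1 m1 n) (quad_field l2 m2 n) \<longleftrightarrow>
      (l1 - l2 = 0 \<and> m2 + m1 = 0)
    \<or> (l1 - l2 = 0 \<and> n + l2 = 0)
    \<or> (l1 = 0 \<and> l2 = 0 \<and> m2 = 0 \<and> n = 0)
    \<or> (l1 + 1 = 0 \<and> l2 + 1 = 0 \<and> m2 = 0 \<and> n - 1 = 0)
    \<or> (l1 = 0 \<and> l2 = 0 \<and> m1 = 0 \<and> n = 0)
    \<or> (l1 + 1 = 0 \<and> l2 + 1 = 0 \<and> m1 = 0 \<and> n - 1 = 0)" (is "?center \<longleftrightarrow> ?conds")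
proof
  assume ?center
  then show ?conds using center_necessary[of l1 m1 n l2 m2] by auto
next
  assume ?conds
  then have "l1 = l2" "m1 = - m2 \<or> l1 + n = 0" by auto
  then show ?center using center_sufficient[of m1 m2 l1 n] by simp
qed

end
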